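(* The subset $\mathfrak{grt}_1\subset\mathfrak G$ is equal to the set of all elements $C\in\mathfrak G_{\mathrm{inert}}$ such that there exist a derivation $D\in\mathfrak{der}(\mathfrak t_4)$ and an element $X\in\mathfrak t_4$ satisfying: (a) the morphism $\mu_{123}:\mathfrak t_3\to\mathfrak t_4$, $x\mapsto x^{1,2,3}$, intertwines $D_C$ and $D$; and (b) the morphism $\mu_{124}:\mathfrak t_3\to\mathfrak t_4$, $x\mapsto x^{1,2,4}$, intertwines $D_C$ and $D+\mathrm{ad}_X$.
   Context: $\mathbf k$ is a commutative $\mathbb Q$-algebra with unit; Lie algebras are over $\mathbf k$. $[1,n]=\{1,\dots,n\}$. $\mathfrak{der}(\mathfrak a)$ is the Lie algebra of derivations of $\mathfrak a$; $\mathrm{ad}_X(x)=[X,x]$. A Lie algebra morphism $f:\mathfrak a\to\mathfrak b$ intertwines $D\in\mathfrak{der}(\mathfrak a)$ and $E\in\mathfrak{der}(\mathfrak b)$ if $E\circ f=f\circ D$. For $n\ge 2$, $\mathfrak t_n$ is the Lie algebra with generators $t_{ij}$ ($i\ne j\in[1,n]$) and relations $t_{ji}=t_{ij}$, $[t_{ij}+t_{ik},t_{jk}]=0$ for distinct $i,j,k$, and $[t_{ij},t_{kl}]=0$ for distinct $i,j,k,l$; it is graded with $\deg t_{ij}=1$. A partially defined map $\phi:[1,m]\supset S_\phi\to[1,n]$, identified with the sequence of its fibers $\phi^{-1}(1),\dots,\phi^{-1}(n)$, defines a Lie algebra morphism $\mathfrak t_n\to\mathfrak t_m$, $x\mapsto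 x^\phi$, by $t_{ij}\mapsto\sum_{i',j':\,\phi(i')=i,\ \phi(j')=j}t_{i'j'}$. (E.g. $x\mapsto x^{1,2,4}$ sends $t_{12},t_{13},t_{23}$ to $t_{12},t_{14},t_{24}$; $x\mapsto x^{1,23,4}$ sends them to $t_{12}+t_{13},\,t_{14},\,t_{24}+t_{34}$.) $\mathfrak{lie}(e_0,e_1)$ is the free Lie algebra on $e_0,e_1$ (degree 1), $e_\infty:=-e_0-e_1$, and $\mathfrak G\subset\mathfrak{lie}(e_0,e_1)$ is the sum of its components of degree $>1$. For $C\in\mathfrak{lie}(e_0,e_1)$ and $a,b$ in a Lie algebra, $C(a,b)$ is the image of $C$ under $e_0\mapsto a,e_1\mapsto b$. $\mathfrak{lie}(e_0,e_1)$ is embedded in $\mathfrak t_3$ by $e_0\mapsto t_{23}$, $e_1\mapsto t_{12}$. Let $\mathrm{pent}:\mathfrak t_3\to\mathfrak t_4$, $C\mapsto C^{2,3,4}+C^{1,23,4}+C^{1,2,3}-C^{12,3,4}-C^{1,2,34}$. $\mathfrak{grt}_1$ is the set of $C\in\mathfrak{lie}(e_0,e_1)$ such that $C(e_0,e_1)+C(e_1,e_0)=0$, $C(e_0,e_1)+C(e_1,e_\infty)+C(e_\infty,e_0)=0$, $[e_1,C(e_0,e_1)]+[e_\infty,C(e_0,e_\infty)]=0$ and $\mathrm{pent}(C)=0$. $\mathfrak G_{\mathrm{inert}}$ is the set of $C\in\mathfrak G$ such that there exists $h_C\in\mathfrak G$ (necessarily unique) with $[C,e_0]+[h_C,e_\infty]=0$.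 For $C\in\mathfrak G_{\mathrm{inert}}$, $D_C$ is the derivation of $\mathfrak t_3$ given by $t_{12}\mapsto0$, $t_{23}\mapsto[C(t_{23},t_{12}),t_{23}]$, $t_{13}\mapsto[h_C(t_{23},t_{12}),t_{13}]$. *)

theory Defs
  imports Complex_Main "HOL-Library.Numeral_Type"
begin

section \<open>Commutative \<open>\<rat>\<close>-algebras and Lie algebras over them\<close>

class comm_rat_algebra = comm_ring_1 +
  assumes ex_rat_hom:
    "\<exists>\<iota>::rat \<Rightarrow> 'a. \<iota> 1 = 1 \<and> (\<forall>x y. \<iota> (x + y) = \<iota> x + \<iota> y) \<and> (\<forall>x y. \<iota> (x * y) = \<iota> x * \<iota> y)"

class lie_ring = ab_group_add +
  fixes lie_bracket :: "'a \<Rightarrow> 'a \<Rightarrow> 'a"  ("(\<open>indent=1 notation=\<open>mixfix lie bracket\<close>\<close>\<lblot>_,/ _\<rblot>)")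
  assumes bracket_add_left: "\<lblot>x + y, z\<rblot> = \<lblot>x, z\<rblot> + \<lblot>y, z\<rblot>"
    and bracket_add_right: "\<lblot>x, y + z\<rblot> = \<lblot>x, y\<rblot> + \<lblot>x, z\<rblot>"
    and bracket_self: "\<lblot>x, x\<rblot> = 0"
    and jacobi: "\<lblot>x, \<lblot>y, z\<rblot>\<rblot> + \<lblot>y, \<lblot>z, x\<rblot>\<rblot> + \<lblot>z, \<lblot>x, y\<rblot>\<rblot> = 0"

locale lie_algebra = module scale
  for scale :: "'k::comm_ring_1 \<Rightarrow> 'a::lie_ring \<Rightarrow> 'a" +
  assumes bracket_scale_left: "\<lblot>scale c x, y\<rblot> = scale c \<lblot>x, y\<rblot>"
    and bracket_scale_right: "\<lblot>x, scale c y\<rblot> = scale c \<lblot>x, y\<rblot>"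

lemma bracket_zero_left [simp]: "\<lblot>0, x :: 'a::lie_ring\<rblot> = 0"
  using bracket_add_left[of 0 0 x] by simp

lemma bracket_zero_right [simp]: "\<lblot>x :: 'a::lie_ring, 0\<rblot> = 0"
  using bracket_add_right[of x 0 0] by simp

lemma bracket_sum_left: "\<lblot>sum f A, y :: 'a::lie_ring\<rblot> = (\<Sum>a\<in>A. \<lblot>f a, y\<rblot>)"
  by (induction A rule: infinite_finite_induct) (simp_all add: bracket_add_left)

lemma bracket_sum_right: "\<lblot>x :: 'a::lie_ring, sum f A\<rblot> = (\<Sum>a\<in>A. \<lblot>x, f a\<rblot>)"
  by (induction A rule: infinite_finite_induct) (simp_all add: bracket_add_right)

definition lie_hom ::
  "('k::comm_ring_1 \<Rightarrow> 'a::lie_ring \<Rightarrow> 'a) \<Rightarrow> ('k \<Rightarrow> 'b::lie_ring \<Rightarrow> 'b) \<Rightarrow> ('a \<Rightarrow> 'b) \<Rightarrow> bool"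
  where "lie_hom s s' f \<longleftrightarrow> module_hom s s' f \<and> (\<forall>x y. f \<lblot>x, y\<rblot> = \<lblot>f x, f y\<rblot>)"

definition der :: "('k::comm_ring_1 \<Rightarrow> 'a::lie_ring \<Rightarrow> 'a) \<Rightarrow> ('a \<Rightarrow> 'a) set"
  where "der s = {D. module_hom s s D \<and> (\<forall>x y. D \<lblot>x, y\<rblot> = \<lblot>D x, y\<rblot> + \<lblot>x, D y\<rblot>)}"

definition ad :: "'a::lie_ring \<Rightarrow> 'a \<Rightarrow> 'a"
  where "ad X x = \<lblot>X, x\<rblot>"

definition intertwines :: "('a \<Rightarrow> 'b) \<Rightarrow> ('a \<Rightarrow> 'a) \<Rightarrow> ('b \<Rightarrow> 'b) \<Rightarrow> bool"
  where "intertwines f D E \<longleftrightarrow> E \<circ> f = f \<circ> D"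


section \<open>Lie algebras presented by generators and relations\<close>

datatype ('k, 'g) lie_term =
    TGen 'g
  | TZero
  | TAdd "('k, 'g) lie_term" "('k, 'g) lie_term"
  | TScale 'k "('k, 'g) lie_term"
  | TBr "('k, 'g) lie_term" "('k, 'g) lie_term"

text \<open>The least congruence that contains \<open>R\<close> and the Lie algebra axioms: the quotient of the
  terms by it is the Lie algebra with generators \<open>'g\<close> and relations \<open>R\<close>.\<close>

inductive lie_cong ::
  "(('k::comm_ring_1, 'g) lie_term \<times> ('k, 'g) lie_term) set \<Rightarrow>
    ('k, 'g) lie_term \<Rightarrow> ('k, 'g) lie_term \<Rightarrow> bool"
  for R
  where
    rel: "(x, y) \<in> R \<Longrightarrow> lie_cong R x y"
  | refl: "lie_cong R x x"
  | sym: "lie_cong R x y \<Longrightarrow> lie_cong R y x"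
  | trans: "lie_cong R x y \<Longrightarrow> lie_cong R y z \<Longrightarrow> lie_cong R x z"
  | add: "lie_cong R x x' \<Longrightarrow> lie_cong R y y' \<Longrightarrow> lie_cong R (TAdd x y) (TAdd x' y')"
  | scale: "lie_cong R x x' \<Longrightarrow> lie_cong R (TScale c x) (TScale c x')"
  | br: "lie_cong R x x' \<Longrightarrow> lie_cong R y y' \<Longrightarrow> lie_cong R (TBr x y) (TBr x' y')"
  | add_assoc: "lie_cong R (TAdd (TAdd x y) z) (TAdd x (TAdd y z))"
  | add_commute: "lie_cong R (TAdd x y) (TAdd y x)"
  | add_zero: "lie_cong R (TAdd TZero x) x"
  | add_neg: "lie_cong R (TAdd (TScale (- 1) x) x) TZero"
  | scale_right_distrib: "lie_cong R (TScale c (TAdd x y)) (TAdd (TScale c x) (TScale c y))"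
  | scale_left_distrib: "lie_cong R (TScale (c + d) x) (TAdd (TScale c x) (TScale d x))"
  | scale_scale: "lie_cong R (TScale c (TScale d x)) (TScale (c * d) x)"
  | scale_one: "lie_cong R (TScale 1 x) x"
  | br_add_left: "lie_cong R (TBr (TAdd x y) z) (TAdd (TBr x z) (TBr y z))"
  | br_add_right: "lie_cong R (TBr x (TAdd y z)) (TAdd (TBr x y) (TBr x z))"
  | br_scale_left: "lie_cong R (TBr (TScale c x) y) (TScale c (TBr x y))"
  | br_scale_right: "lie_cong R (TBr x (TScale c y)) (TScale c (TBr x y))"
  | br_self: "lie_cong R (TBr x x) TZero"
  | br_jacobi: "lie_cong R (TAdd (TAdd (TBr x (TBr y z)) (TBr y (TBr z x))) (TBr z (TBr x y))) TZero"

lemmas lie_cong_axioms =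
  lie_cong.add_assoc lie_cong.add_commute lie_cong.add_zero lie_cong.add_neg
  lie_cong.scale_right_distrib lie_cong.scale_left_distrib lie_cong.scale_scale lie_cong.scale_one
  lie_cong.br_add_left lie_cong.br_add_right lie_cong.br_scale_left lie_cong.br_scale_right
  lie_cong.br_self lie_cong.br_jacobi

lemma equivp_lie_cong: "equivp (lie_cong R)"
  by (intro equivpI reflpI sympI transpI) (blast intro: lie_cong.intros)+

primrec lie_eval :: "('k \<Rightarrow> 'a::lie_ring \<Rightarrow> 'a) \<Rightarrow> ('g \<Rightarrow> 'a) \<Rightarrow> ('k, 'g) lie_term \<Rightarrow> 'a"
  where
    "lie_eval s f (TGen g) = f g"
  | "lie_eval s f TZero = 0"
  | "lie_eval s f (TAdd x y) = lie_eval s f x + lie_eval s f y"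
  | "lie_eval s f (TScale c x) = s c (lie_eval s f x)"
  | "lie_eval s f (TBr x y) = \<lblot>lie_eval s f x, lie_eval s f y\<rblot>"

lemma (in lie_algebra) lie_eval_cong:
  assumes "lie_cong R x y" and "\<And>u v. (u, v) \<in> R \<Longrightarrow> lie_eval scale f u = lie_eval scale f v"
  shows "lie_eval scale f x = lie_eval scale f y"
  using assms(1)
  by induction
    (simp_all add: assms(2) algebra_simps bracket_add_left bracket_add_right bracket_self
      bracket_scale_left bracket_scale_right jacobi jacobi[unfolded add.assoc])


section \<open>Free Lie algebras\<close>

quotient_type (overloaded) ('k, 'g) free_lie = "('k::comm_ring_1, 'g) lie_term" / "lie_cong {}"
  by (rule equivp_lie_cong)

instantiation free_lie :: (comm_ring_1, type) lie_ring
begin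

lift_definition zero_free_lie :: "('a, 'b) free_lie" is TZero .
lift_definition plus_free_lie :: "('a, 'b) free_lie \<Rightarrow> ('a, 'b) free_lie \<Rightarrow> ('a, 'b) free_lie"
  is TAdd by (rule lie_cong.add)
lift_definition uminus_free_lie :: "('a, 'b) free_lie \<Rightarrow> ('a, 'b) free_lie"
  is "TScale (- 1)" by (rule lie_cong.scale)
definition minus_free_lie :: "('a, 'b) free_lie \<Rightarrow> ('a, 'b) free_lie \<Rightarrow> ('a, 'b) free_lie"
  where "minus_free_lie x y = x + (- y)"
lift_definition lie_bracket_free_lie ::
  "('a, 'b) free_lie \<Rightarrow> ('a, 'b) free_lie \<Rightarrow> ('a, 'b) free_lie"
  is TBr by (rule lie_cong.br)

instance
  by standard
    (unfold minus_free_lie_def, (rule HOL.refl | (transfer, rule lie_cong_axioms))+)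

end

lift_definition free_gen :: "'g \<Rightarrow> ('k::comm_ring_1, 'g) free_lie" is TGen .

lift_definition free_scale :: "'k::comm_ring_1 \<Rightarrow> ('k, 'g) free_lie \<Rightarrow> ('k, 'g) free_lie"
  is TScale by (rule lie_cong.scale)

interpretation free_lie: lie_algebra "free_scale :: 'k::comm_ring_1 \<Rightarrow> ('k, 'g) free_lie \<Rightarrow> _"
  by standard (transfer, rule lie_cong_axioms)+

text \<open>The image of \<open>C\<close> under the Lie algebra morphism sending each generator \<open>g\<close> to \<open>f g\<close>; see
  \<open>lie_hom_free_subst\<close> and \<open>free_subst_gen\<close> below.\<close>

definition free_subst ::
  "('k::comm_ring_1 \<Rightarrow> 'a::lie_ring \<Rightarrow> 'a) \<Rightarrow> ('g \<Rightarrow> 'a) \<Rightarrow> ('k, 'g) free_lie \<Rightarrow> 'a"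
  where "free_subst s f C = lie_eval s f (rep_free_lie C)"

lemma (in lie_algebra) free_subst_abs: "free_subst scale f (abs_free_lie x) = lie_eval scale f x"
proof -
  have "lie_cong {} (rep_free_lie (abs_free_lie x)) x"
    by (metis Quotient_free_lie Quotient_rep_abs lie_cong.refl)
  then show ?thesis
    unfolding free_subst_def by (rule lie_eval_cong) simp
qed

lemma (in lie_algebra) free_subst_gen [simp]: "free_subst scale f (free_gen g) = f g"
  by (simp add: free_gen.abs_eq free_subst_abs)

lemma (in lie_algebra) lie_hom_free_subst: "lie_hom free_scale scale (free_subst scale f)"
proof -
  have *: "\<exists>t. x = abs_free_lie t" for x :: "('k::comm_ring_1, 'g) free_lie"
    by (metis Quotient_abs_rep Quotient_free_lie)
  have "free_subst scale f (x + y) = free_subst scale f x + free_subst scale f y"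
    "free_subst scale f (free_scale c x) = scale c (free_subst scale f x)"
    "free_subst scale f \<lblot>x, y\<rblot> = \<lblot>free_subst scale f x, free_subst scale f y\<rblot>" for x y c
    using *[of x] *[of y]
    by (auto simp: plus_free_lie.abs_eq free_scale.abs_eq lie_bracket_free_lie.abs_eq free_subst_abs)
  then show ?thesis
    unfolding lie_hom_def module_hom_iff
    using free_lie.module_axioms module_axioms by blast
qed

inductive homogeneous :: "nat \<Rightarrow> ('k::comm_ring_1, 'g) free_lie \<Rightarrow> bool"
  where
    gen: "homogeneous 1 (free_gen g)"
  | zero: "homogeneous n 0"
  | add: "homogeneous n x \<Longrightarrow> homogeneous n y \<Longrightarrow> homogeneous n (x + y)"
  | scale: "homogeneous n x \<Longrightarrow> homogeneous n (free_scale c x)"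
  | br: "homogeneous m x \<Longrightarrow> homogeneous n y \<Longrightarrow> homogeneous (m + n) \<lblot>x, y\<rblot>"


section \<open>The Lie algebras \<open>\<tt>\<^sub>n\<close>\<close>

text \<open>The index set \<open>[1,n]\<close> is a finite type \<open>'n\<close>, for \<open>\<tt>\<^sub>3\<close> and \<open>\<tt>\<^sub>4\<close> the numeral types \<open>3\<close> and \<open>4\<close>
  (arithmetic modulo \<open>n\<close>, so that \<open>1, \<dots>, n\<close> denote the \<open>n\<close> distinct elements, with \<open>n = 0\<close>).
  The additional generators \<open>t\<^sub>i\<^sub>i\<close> are only there to have a total indexing; they are set to \<open>0\<close>.\<close>

definition dk_rels :: "(('k, 'n \<times> 'n) lie_term \<times> ('k, 'n \<times> 'n) lie_term) set"
  where
  "dk_rels =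
     {(TGen (i, i), TZero) | i. True} \<union>
     {(TGen (j, i), TGen (i, j)) | i j. i \<noteq> j} \<union>
     {(TBr (TAdd (TGen (i, j)) (TGen (i, k))) (TGen (j, k)), TZero) | i j k. distinct [i, j, k]} \<union>
     {(TBr (TGen (i, j)) (TGen (k, l)), TZero) | i j k l. distinct [i, j, k, l]}"

quotient_type (overloaded) ('k, 'n) dk = "('k::comm_ring_1, 'n \<times> 'n) lie_term" / "lie_cong dk_rels"
  by (rule equivp_lie_cong)

instantiation dk :: (comm_ring_1, type) lie_ring
begin

lift_definition zero_dk :: "('a, 'b) dk" is TZero .
lift_definition plus_dk :: "('a, 'b) dk \<Rightarrow> ('a, 'b) dk \<Rightarrow> ('a, 'b) dk"
  is TAdd by (rule lie_cong.add)
lift_definition uminus_dk :: "('a, 'b) dk \<Rightarrow> ('a, 'b) dk"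
  is "TScale (- 1)" by (rule lie_cong.scale)
definition minus_dk :: "('a, 'b) dk \<Rightarrow> ('a, 'b) dk \<Rightarrow> ('a, 'b) dk"
  where "minus_dk x y = x + (- y)"
lift_definition lie_bracket_dk :: "('a, 'b) dk \<Rightarrow> ('a, 'b) dk \<Rightarrow> ('a, 'b) dk"
  is TBr by (rule lie_cong.br)

instance
  by standard
    (unfold minus_dk_def, (rule HOL.refl | (transfer, rule lie_cong_axioms))+)

end

lift_definition tt :: "'n \<Rightarrow> 'n \<Rightarrow> ('k::comm_ring_1, 'n) dk" is "\<lambda>i j. TGen (i, j)" .

lift_definition dk_scale :: "'k::comm_ring_1 \<Rightarrow> ('k, 'n) dk \<Rightarrow> ('k, 'n) dk"
  is TScale by (rule lie_cong.scale)

interpretation dk: lie_algebra "dk_scale :: 'k::comm_ring_1 \<Rightarrow> ('k, 'n) dk \<Rightarrow> _"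
  by standard (transfer, rule lie_cong_axioms)+

lemma t_self [simp]: "tt i i = 0"
  by transfer (rule lie_cong.rel, auto simp: dk_rels_def)

lemma t_commute: "tt j i = tt i j"
  by (cases "i = j", simp, transfer, rule lie_cong.rel, auto simp: dk_rels_def)

lemma t_rel3: "distinct [i, j, k] \<Longrightarrow> \<lblot>tt i j + tt i k, tt j k\<rblot> = 0"
  by transfer (rule lie_cong.rel, fastforce simp: dk_rels_def)

lemma t_rel4: "distinct [i, j, k, l] \<Longrightarrow> \<lblot>tt i j, tt k l\<rblot> = 0"
  by transfer (rule lie_cong.rel, fastforce simp: dk_rels_def)

text \<open>\<open>dk_pull \<phi>\<close> is the morphism \<open>x \<mapsto> x\<^sup>\<phi>\<close> from \<open>\<tt>\<^sub>n\<close> to \<open>\<tt>\<^sub>m\<close> given by a partially defined map \<open>\<phi>\<close>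
  from \<open>[1,m]\<close> to \<open>[1,n]\<close>; for instance \<open>x\<^sup>1\<^sup>,\<^sup>2\<^sup>3\<^sup>,\<^sup>4\<close> is \<open>dk_pull [1 \<mapsto> 1, 2 \<mapsto> 2, 3 \<mapsto> 2, 4 \<mapsto> 3] x\<close>.\<close>

definition pull_gen :: "('m::finite \<rightharpoonup> 'n) \<Rightarrow> 'n \<times> 'n \<Rightarrow> ('k::comm_ring_1, 'm) dk"
  where
  "pull_gen \<phi> = (\<lambda>(i, j). if i = j then 0
     else \<Sum>i' | \<phi> i' = Some i. \<Sum>j' | \<phi> j' = Some j. tt i' j')"

lemma pull_gen_rels:
  fixes \<phi> :: "'m::finite \<rightharpoonup> 'n" and u v :: "('k::comm_ring_1, 'n \<times> 'n) lie_term"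
  assumes "(u, v) \<in> dk_rels"
  shows "lie_eval dk_scale (pull_gen \<phi>) u = lie_eval dk_scale (pull_gen \<phi>) v"
proof -
  let ?g = "pull_gen \<phi> :: 'n \<times> 'n \<Rightarrow> ('k, 'm) dk"
  have self: "?g (i, i) = 0" for i
    by (simp add: pull_gen_def)
  have comm: "?g (j, i) = ?g (i, j)" for i j
    by (simp add: pull_gen_def) (subst sum.swap, simp add: t_commute)
  have rel3: "\<lblot>?g (i, j) + ?g (i, k), ?g (j, k)\<rblot> = 0"
    if d: "distinct [i, j, k]" for i j k
  proof -
    let ?F = "\<lambda>i. {i'. \<phi> i' = Some i}"
    have one: "\<lblot>(\<Sum>b\<in>?F j. tt a b) + (\<Sum>c\<in>?F k. tt a c), tt b' c'\<rblot> = (0 :: ('k, 'm) dk)"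
      if "a \<in> ?F i" "b' \<in> ?F j" "c' \<in> ?F k" for a b' c'
    proof -
      have "\<lblot>tt a b, tt b' c'\<rblot> = (0 :: ('k, 'm) dk)" if "b \<in> ?F j - {b'}" for b
        by (rule t_rel4) (use d that \<open>a \<in> _\<close> \<open>b' \<in> _\<close> \<open>c' \<in> _\<close> in auto)
      moreover have "\<lblot>tt a c, tt b' c'\<rblot> = (0 :: ('k, 'm) dk)" if "c \<in> ?F k - {c'}" for c
        by (rule t_rel4) (use d that \<open>a \<in> _\<close> \<open>b' \<in> _\<close> \<open>c' \<in> _\<close> in auto)
      ultimately have "\<lblot>(\<Sum>b\<in>?F j. tt a b) + (\<Sum>c\<in>?F k. tt a c), tt b' c'\<rblot> =
          \<lblot>tt a b' + tt a c', tt b' c' :: ('k, 'm) dk\<rblot>"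
        using that
        by (simp add: bracket_add_left bracket_sum_left sum.remove[of _ b'] sum.remove[of _ c'])
      also have "\<dots> = 0"
        by (rule t_rel3) (use d that in auto)
      finally show ?thesis .
    qed
    have "\<lblot>?g (i, j) + ?g (i, k), ?g (j, k)\<rblot> =
        (\<Sum>a\<in>?F i. \<Sum>b'\<in>?F j. \<Sum>c'\<in>?F k.
          \<lblot>(\<Sum>b\<in>?F j. tt a b) + (\<Sum>c\<in>?F k. tt a c), tt b' c' :: ('k, 'm) dk\<rblot>)"
      using d by (simp add: pull_gen_def sum.distrib[symmetric])
        (simp only: bracket_sum_left[of _ "?F i"], simp only: bracket_sum_right)
    also have "\<dots> = 0"
      by (intro sum.neutral ballI) (rule one)
    finally show ?thesis .
  qed
  have rel4: "\<lblot>?g (i, j), ?g (k, l)\<rblot> = 0" if d: "distinct [i, j, k, l]" for i j k l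
    using d by (auto simp: pull_gen_def bracket_sum_left bracket_sum_right intro!: sum.neutral t_rel4)
  show ?thesis
    using assms self comm rel3 rel4 by (auto simp: dk_rels_def)
qed

lift_definition dk_pull ::
  "('m::finite \<rightharpoonup> 'n) \<Rightarrow> ('k::comm_ring_1, 'n) dk \<Rightarrow> ('k, 'm) dk"
  is "\<lambda>\<phi>. lie_eval dk_scale (pull_gen \<phi>)"
  by (rule dk.lie_eval_cong) (auto intro: pull_gen_rels)

lemma dk_pull_t:
  "i \<noteq> j \<Longrightarrow> dk_pull \<phi> (tt i j) = (\<Sum>i' | \<phi> i' = Some i. \<Sum>j' | \<phi> j' = Some j. tt i' j')"
  by (simp add: tt.abs_eq dk_pull.abs_eq) (simp add: pull_gen_def tt.abs_eq)

lemma lie_hom_dk_pull: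
  fixes \<phi> :: "'m::finite \<rightharpoonup> 'n"
  shows "lie_hom dk_scale dk_scale (dk_pull \<phi> :: ('k::comm_ring_1, 'n) dk \<Rightarrow> ('k, 'm) dk)"
proof -
  let ?f = "dk_pull \<phi> :: ('k, 'n) dk \<Rightarrow> ('k, 'm) dk"
  have "?f (x + y) = ?f x + ?f y" "?f (dk_scale c x) = dk_scale c (?f x)"
    "?f \<lblot>x, y\<rblot> = \<lblot>?f x, ?f y\<rblot>" for x y c
    by (transfer, simp)+
  then show ?thesis
    unfolding lie_hom_def module_hom_iff by (simp add: dk.module_axioms)
qed


section \<open>\<open>\<gg>\<rr>\<tt>\<^sub>1\<close> and the derivations \<open>D\<^sub>C\<close>\<close>

datatype letter = L0 | L1

type_synonym 'k lie2 = "('k, letter) free_lie"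

definition e0 :: "'k::comm_ring_1 lie2" where "e0 = free_gen L0"
definition e1 :: "'k::comm_ring_1 lie2" where "e1 = free_gen L1"
definition einf :: "'k::comm_ring_1 lie2" where "einf = - e0 - e1"

definition subst2 ::
  "('k::comm_ring_1 \<Rightarrow> 'a::lie_ring \<Rightarrow> 'a) \<Rightarrow> 'k lie2 \<Rightarrow> 'a \<Rightarrow> 'a \<Rightarrow> 'a"
  where "subst2 s C a b = free_subst s (case_letter a b) C"

abbreviation subst_lie2 :: "'k::comm_ring_1 lie2 \<Rightarrow> 'k lie2 \<Rightarrow> 'k lie2 \<Rightarrow> 'k lie2"
  where "subst_lie2 \<equiv> subst2 free_scale"

abbreviation subst_dk :: "'k::comm_ring_1 lie2 \<Rightarrow> ('k, 'n) dk \<Rightarrow> ('k, 'n) dk \<Rightarrow> ('k, 'n) dk"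
  where "subst_dk \<equiv> subst2 dk_scale"

definition frakG :: "'k::comm_ring_1 lie2 set"
  where "frakG = free_lie.span {x. \<exists>n>1. homogeneous n x}"

definition emb :: "'k::comm_ring_1 lie2 \<Rightarrow> ('k, 3) dk"
  where "emb C = subst_dk C (tt 2 3) (tt 1 2)"

definition pent :: "('k::comm_ring_1, 3) dk \<Rightarrow> ('k, 4) dk"
  where
  "pent C =
     dk_pull [2 \<mapsto> 1, 3 \<mapsto> 2, 4 \<mapsto> 3] C
     + dk_pull [1 \<mapsto> 1, 2 \<mapsto> 2, 3 \<mapsto> 2, 4 \<mapsto> 3] C
     + dk_pull [1 \<mapsto> 1, 2 \<mapsto> 2, 3 \<mapsto> 3] C
     - dk_pull [1 \<mapsto> 1, 2 \<mapsto> 1, 3 \<mapsto> 2, 4 \<mapsto> 3] C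
     - dk_pull [1 \<mapsto> 1, 2 \<mapsto> 2, 3 \<mapsto> 3, 4 \<mapsto> 3] C"

definition grt1 :: "'k::comm_rat_algebra lie2 set"
  where
  "grt1 = {C.
     subst_lie2 C e0 e1 + subst_lie2 C e1 e0 = 0 \<and>
     subst_lie2 C e0 e1 + subst_lie2 C e1 einf + subst_lie2 C einf e0 = 0 \<and>
     \<lblot>e1, subst_lie2 C e0 e1\<rblot> + \<lblot>einf, subst_lie2 C e0 einf\<rblot> = 0 \<and>
     pent (emb C) = 0}"

definition G_inert :: "'k::comm_rat_algebra lie2 set"
  where "G_inert = {C \<in> frakG. \<exists>h\<in>frakG. \<lblot>C, e0\<rblot> + \<lblot>h, einf\<rblot> = 0}"

text \<open>\<open>h_of C\<close> and \<open>D_of C\<close> are meaningful for \<open>C \<in> G_inert\<close>. Then \<open>h_of C\<close> is unique because the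
  centralizer of \<open>einf\<close> in the free Lie algebra is spanned by \<open>einf\<close>. A derivation with the given
  values on the generators is unique, and it exists because the relations of \<open>\<tt>\<^sub>3\<close> say that
  \<open>t\<^sub>1\<^sub>2 + t\<^sub>1\<^sub>3 + t\<^sub>2\<^sub>3\<close> is central and the equation defining \<open>h_of C\<close> makes the derivation vanish on
  this element.\<close>

definition h_of :: "'k::comm_rat_algebra lie2 \<Rightarrow> 'k lie2"
  where "h_of C = (THE h. h \<in> frakG \<and> \<lblot>C, e0\<rblot> + \<lblot>h, einf\<rblot> = 0)"

definition D_of :: "'k::comm_rat_algebra lie2 \<Rightarrow> ('k, 3) dk \<Rightarrow> ('k, 3) dk"
  where
  "D_of C = (THE D. D \<in> der dk_scale \<and>
     D (tt 1 2) = 0 \<and>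
     D (tt 2 3) = \<lblot>subst_dk C (tt 2 3) (tt 1 2), tt 2 3\<rblot> \<and>
     D (tt 1 3) = \<lblot>subst_dk (h_of C) (tt 2 3) (tt 1 2), tt 1 3\<rblot>)"

definition mu123 :: "('k::comm_ring_1, 3) dk \<Rightarrow> ('k, 4) dk"
  where "mu123 = dk_pull [1 \<mapsto> 1, 2 \<mapsto> 2, 3 \<mapsto> 3]"

definition mu124 :: "('k::comm_ring_1, 3) dk \<Rightarrow> ('k, 4) dk"
  where "mu124 = dk_pull [1 \<mapsto> 1, 2 \<mapsto> 2, 4 \<mapsto> 3]"

end

theory Submission
  imports Defs "HOL-Library.Function_Algebras"
begin

text \<open>
  Write \<open>h = h_of C\<close>. The values of \<open>D\<close> on all \<open>t\<^sub>i\<^sub>j\<close> except \<open>t\<^sub>3\<^sub>4\<close> are forced by the two intertwining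
  conditions, which also give \<open>[X, t\<^sub>1\<^sub>2] = 0\<close>, hence \<open>X = P(t\<^sub>3\<^sub>4, t\<^sub>1\<^sub>3 + t\<^sub>2\<^sub>3)\<close> up to \<open>t\<^sub>1\<^sub>2\<close> and the center.
  Applying \<open>D\<close> to \<open>[t\<^sub>1\<^sub>3, t\<^sub>2\<^sub>4] = 0\<close> gives \<open>[t\<^sub>1\<^sub>3, [t\<^sub>2\<^sub>4, W]] = 0\<close> for \<open>W = h(t\<^sub>2\<^sub>3, t\<^sub>1\<^sub>2) - C(t\<^sub>2\<^sub>4, t\<^sub>1\<^sub>2) + X\<close>,
  which forces \<open>W = Q(t\<^sub>2\<^sub>4, t\<^sub>1\<^sub>2 + t\<^sub>2\<^sub>3) + R(t\<^sub>1\<^sub>3, t\<^sub>1\<^sub>2 + t\<^sub>1\<^sub>4)\<close> up to the center; \<open>[t\<^sub>2\<^sub>3, t\<^sub>1\<^sub>4] = 0\<close> is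
  treated in the same way. Removing each of the four strands from these two equations identifies
  \<open>P\<close>, \<open>Q\<close>, \<open>R\<close> with substitution instances of \<open>C\<close>, yields the antisymmetry of \<open>C\<close> and
  \<open>h = - C(e\<^sub>1, e\<^sub>\<infinity>)\<close>, and turns the first equation into the pentagon with permuted strands. The other
  equations of \<open>\<gg>\<rr>\<tt>\<^sub>1\<close> follow, the hexagon because its left-hand side commutes with \<open>e\<^sub>\<infinity>\<close>.

  Conversely one takes \<open>X = C(t\<^sub>1\<^sub>3 + t\<^sub>2\<^sub>3, t\<^sub>1\<^sub>4 + t\<^sub>2\<^sub>4)\<close> and lets \<open>D\<close> kill the central sum of all
  \<open>t\<^sub>i\<^sub>j\<close>. Then the relations to be checked reduce to those of the two copies of \<open>\<tt>\<^sub>3\<close> and the three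
  commutation relations, and two of the latter are the pentagon with permuted strands.

  The centralizers are computed from \<open>\<tt>\<^sub>4 = L + \<tt>\<^sub>3\<close> with \<open>L\<close> free on \<open>t\<^sub>1\<^sub>4, t\<^sub>2\<^sub>4, t\<^sub>3\<^sub>4\<close>, where \<open>\<tt>\<^sub>3\<close> is
  embedded by \<open>x \<mapsto> x\<^sup>1\<^sup>,\<^sup>2\<^sup>,\<^sup>3\<^sup>4\<close> and so commutes with \<open>t\<^sub>3\<^sub>4\<close>, and from the fact that the centralizer of
  a generator of a free Lie algebra consists of its multiples.
\<close>

section \<open>Finite strand sets, elementary bracket identities and induction principles\<close>

lemma exhaust3: fixes x :: 3 shows "x = 1 \<or> x = 2 \<or> x = 3"
proof (induct x)
  case (of_int z) then have "z = 0 \<or> z = 1 \<or> z = 2" by auto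
  then show ?case by auto
qed
lemma exhaust4: fixes x :: 4 shows "x = 1 \<or> x = 2 \<or> x = 3 \<or> x = 4"
proof (induct x)
  case (of_int z) then have "z = 0 \<or> z = 1 \<or> z = 2 \<or> z = 3" by auto
  then show ?case by auto
qed
lemma neq3: "(1::3) \<noteq> 2" "(1::3) \<noteq> 3" "(2::3) \<noteq> 3" by simp_all
lemma neq4: "(1::4) \<noteq> 2" "(1::4) \<noteq> 3" "(1::4) \<noteq> 4" "(2::4) \<noteq> 3" "(2::4) \<noteq> 4" "(3::4) \<noteq> 4" by simp_all

lemma sum_Collect3:
  fixes f :: "3 \<Rightarrow> 'a::comm_monoid_add"
  shows "(\<Sum>x | P x. f x) = (if P 1 then f 1 else 0) + (if P 2 then f 2 else 0) + (if P 3 then f 3 else 0)"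
proof -
  have U: "UNIV = {1, 2, 3 :: 3}" using exhaust3 by blast
  have "(\<Sum>x | P x. f x) = (\<Sum>x\<in>UNIV. if P x then f x else 0)"
    by (rule sum.mono_neutral_cong_left) auto
  also have "\<dots> = (if P 1 then f 1 else 0) + (if P 2 then f 2 else 0) + (if P 3 then f 3 else 0)"
    unfolding U by (simp only: sum.insert finite.intros sum.empty insert_iff empty_iff neq3 simp_thms not_False_eq_True add_0_right add.assoc)
  finally show ?thesis .
qed

lemma sum_Collect4:
  fixes f :: "4 \<Rightarrow> 'a::comm_monoid_add"
  shows "(\<Sum>x | P x. f x) = (if P 1 then f 1 else 0) + (if P 2 then f 2 else 0) + (if P 3 then f 3 else 0) + (if P 4 then f 4 else 0)"
proof -
  have U: "UNIV = {1, 2, 3, 4 :: 4}" using exhaust4 by blast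
  have "(\<Sum>x | P x. f x) = (\<Sum>x\<in>UNIV. if P x then f x else 0)"
    by (rule sum.mono_neutral_cong_left) auto
  also have "\<dots> = (if P 1 then f 1 else 0) + (if P 2 then f 2 else 0) + (if P 3 then f 3 else 0) + (if P 4 then f 4 else 0)"
    unfolding U by (simp only: sum.insert finite.intros sum.empty insert_iff empty_iff neq4 simp_thms not_False_eq_True add_0_right add.assoc)
  finally show ?thesis .
qed

lemma bracket_uminus_left [simp]: "\<lblot>- x, y :: 'a::lie_ring\<rblot> = - \<lblot>x, y\<rblot>"
  using bracket_add_left[of "- x" x y] by (simp add: eq_neg_iff_add_eq_0)

lemma bracket_uminus_right [simp]: "\<lblot>x, - y :: 'a::lie_ring\<rblot> = - \<lblot>x, y\<rblot>"
  using bracket_add_right[of x "- y" y] by (simp add: eq_neg_iff_add_eq_0)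

lemma bracket_diff_left: "\<lblot>x - y, z :: 'a::lie_ring\<rblot> = \<lblot>x, z\<rblot> - \<lblot>y, z\<rblot>"
  using bracket_add_left[of x "- y" z] by simp

lemma bracket_diff_right: "\<lblot>x, y - z :: 'a::lie_ring\<rblot> = \<lblot>x, y\<rblot> - \<lblot>x, z\<rblot>"
  using bracket_add_right[of x y "- z"] by simp

lemma bracket_anticommute: "\<lblot>y, x :: 'a::lie_ring\<rblot> = - \<lblot>x, y\<rblot>"
proof -
  have "\<lblot>x + y, x + y\<rblot> = (\<lblot>x, x\<rblot> + \<lblot>x, y\<rblot>) + (\<lblot>y, x\<rblot> + \<lblot>y, y\<rblot>)"
    by (simp only: bracket_add_left bracket_add_right add.assoc add.left_commute)
  then have "\<lblot>y, x\<rblot> + \<lblot>x, y\<rblot> = 0" by (simp add: bracket_self add.commute)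
  then show ?thesis by (simp only: eq_neg_iff_add_eq_0)
qed

lemma bracket_eq_0_commute: "\<lblot>x, y :: 'a::lie_ring\<rblot> = 0 \<Longrightarrow> \<lblot>y, x\<rblot> = 0"
  by (subst bracket_anticommute) simp

lemma bracket_bracket_right: "\<lblot>x, \<lblot>y, z :: 'a::lie_ring\<rblot>\<rblot> = \<lblot>\<lblot>x, y\<rblot>, z\<rblot> + \<lblot>y, \<lblot>x, z\<rblot>\<rblot>"
proof -
  have "\<lblot>z, \<lblot>x, y\<rblot>\<rblot> = - \<lblot>\<lblot>x, y\<rblot>, z\<rblot>" by (rule bracket_anticommute)
  moreover have "\<lblot>y, \<lblot>z, x\<rblot>\<rblot> = - \<lblot>y, \<lblot>x, z\<rblot>\<rblot>" by (subst bracket_anticommute[of z x]) simp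
  ultimately have "\<lblot>x, \<lblot>y, z\<rblot>\<rblot> - \<lblot>y, \<lblot>x, z\<rblot>\<rblot> - \<lblot>\<lblot>x, y\<rblot>, z\<rblot> = 0" using jacobi[of x y z] by simp
  then show ?thesis by (simp add: algebra_simps)
qed

lemma bracket_bracket_left: "\<lblot>\<lblot>x, y\<rblot>, z :: 'a::lie_ring\<rblot> = \<lblot>x, \<lblot>y, z\<rblot>\<rblot> - \<lblot>y, \<lblot>x, z\<rblot>\<rblot>"
  using bracket_bracket_right[of x y z] by simp

lemmas bracket_distribs = bracket_add_left bracket_add_right bracket_diff_left bracket_diff_right

lemma lie_homD:
  assumes "lie_hom s s' f"
  shows "f 0 = 0" "f (x + y) = f x + f y" "f (- x) = - f x" "f (x - y) = f x - f y"
    "f (s c x) = s' c (f x)" "f \<lblot>x, y\<rblot> = \<lblot>f x, f y\<rblot>"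
proof -
  have "module_hom s s' f" using assms by (simp add: lie_hom_def)
  then interpret module_hom s s' f .
  show "f 0 = 0" "f (x + y) = f x + f y" "f (- x) = - f x" "f (x - y) = f x - f y"
    "f (s c x) = s' c (f x)" by (simp_all add: add diff neg scale)
  show "f \<lblot>x, y\<rblot> = \<lblot>f x, f y\<rblot>" using assms by (simp add: lie_hom_def)
qed

lemma derD:
  assumes "D \<in> der s"
  shows "D 0 = 0" "D (x + y) = D x + D y" "D (- x) = - D x" "D (x - y) = D x - D y"
    "D (s c x) = s c (D x)" "D \<lblot>x, y\<rblot> = \<lblot>D x, y\<rblot> + \<lblot>x, D y\<rblot>"
proof -
  have "module_hom s s D" using assms by (simp add: der_def)
  then interpret module_hom s s D .
  show "D 0 = 0" "D (x + y) = D x + D y" "D (- x) = - D x" "D (x - y) = D x - D y"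
    "D (s c x) = s c (D x)" by (simp_all add: add diff neg scale)
  show "D \<lblot>x, y\<rblot> = \<lblot>D x, y\<rblot> + \<lblot>x, D y\<rblot>" using assms by (simp add: der_def)
qed

lemma free_lie_induct [case_names gen zero add scale br]:
  assumes "\<And>g. P (free_gen g)" "P 0" "\<And>x y. P x \<Longrightarrow> P y \<Longrightarrow> P (x + y)"
    "\<And>c x. P x \<Longrightarrow> P (free_scale c x)" "\<And>x y. P x \<Longrightarrow> P y \<Longrightarrow> P \<lblot>x, y\<rblot>"
  shows "P (z :: ('k::comm_ring_1, 'g) free_lie)"
proof -
  have "P (abs_free_lie t)" for t
  proof (induction t)
    case (TGen x) then show ?case using assms(1) by (simp add: free_gen.abs_eq)
  next
    case TZero then show ?case using assms(2) by (simp add: zero_free_lie_def)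
  next
    case (TAdd t1 t2) then show ?case using assms(3) by (simp flip: plus_free_lie.abs_eq)
  next
    case (TScale x1 t) then show ?case using assms(4) by (simp flip: free_scale.abs_eq)
  next
    case (TBr t1 t2) then show ?case using assms(5) by (simp flip: lie_bracket_free_lie.abs_eq)
  qed
  then show ?thesis by (metis Quotient_abs_rep Quotient_free_lie)
qed

lemma dk_induct [case_names gen zero add scale br]:
  assumes "\<And>i j. P (tt i j)" "P 0" "\<And>x y. P x \<Longrightarrow> P y \<Longrightarrow> P (x + y)"
    "\<And>c x. P x \<Longrightarrow> P (dk_scale c x)" "\<And>x y. P x \<Longrightarrow> P y \<Longrightarrow> P \<lblot>x, y\<rblot>"
  shows "P (z :: ('k::comm_ring_1, 'n) dk)"
proof -
  have "P (abs_dk t)" for t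
  proof (induction t)
    case (TGen x) then show ?case using assms(1) by (cases x) (simp add: tt.abs_eq)
  next
    case TZero then show ?case using assms(2) by (simp add: zero_dk_def)
  next
    case (TAdd t1 t2) then show ?case using assms(3) by (simp flip: plus_dk.abs_eq)
  next
    case (TScale x1 t) then show ?case using assms(4) by (simp flip: dk_scale.abs_eq)
  next
    case (TBr t1 t2) then show ?case using assms(5) by (simp flip: lie_bracket_dk.abs_eq)
  qed
  then show ?thesis by (metis Quotient_abs_rep Quotient_dk)
qed

section \<open>Representations and cocycles of presented Lie algebras\<close>

text \<open>The commutator of arbitrary functions is not bilinear, so \<open>lie_eval\<close> does
  not apply to operators. Linearity is supplied through assumptions on the generators
  instead.\<close>

primrec rep_eval ::
  "('k \<Rightarrow> 'v \<Rightarrow> 'v::ab_group_add) \<Rightarrow> ('g \<Rightarrow> 'v \<Rightarrow> 'v) \<Rightarrow> ('k, 'g) lie_term \<Rightarrow> 'v \<Rightarrow> 'v"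
  where
    "rep_eval s r (TGen g) = r g"
  | "rep_eval s r TZero = (\<lambda>v. 0)"
  | "rep_eval s r (TAdd x y) = (\<lambda>v. rep_eval s r x v + rep_eval s r y v)"
  | "rep_eval s r (TScale c x) = (\<lambda>v. s c (rep_eval s r x v))"
  | "rep_eval s r (TBr x y) =
      (\<lambda>v. rep_eval s r x (rep_eval s r y v) - rep_eval s r y (rep_eval s r x v))"

text \<open>A function on the generators extends to a 1-cocycle with values in the representation
  \<open>rep_eval s r\<close>. The adjoint representation gives derivations, the trivial one linear parts.\<close>

primrec coc_eval ::
  "('k \<Rightarrow> 'v \<Rightarrow> 'v::ab_group_add) \<Rightarrow> ('g \<Rightarrow> 'v \<Rightarrow> 'v) \<Rightarrow> ('g \<Rightarrow> 'v) \<Rightarrow> ('k, 'g) lie_term \<Rightarrow> 'v"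
  where
    "coc_eval s r d (TGen g) = d g"
  | "coc_eval s r d TZero = 0"
  | "coc_eval s r d (TAdd x y) = coc_eval s r d x + coc_eval s r d y"
  | "coc_eval s r d (TScale c x) = s c (coc_eval s r d x)"
  | "coc_eval s r d (TBr x y) =
      rep_eval s r x (coc_eval s r d y) - rep_eval s r y (coc_eval s r d x)"

lemma module_hom_simps:
  assumes "module_hom s s' f"
  shows "f (x + y) = f x + f y" "f (s c x) = s' c (f x)" "f 0 = 0" "f (- x) = - f x"
    "f (x - y) = f x - f y"
proof -
  interpret module_hom s s' f by fact
  show "f (x + y) = f x + f y" "f (s c x) = s' c (f x)" "f 0 = 0" "f (- x) = - f x"
    "f (x - y) = f x - f y" by (simp_all add: add diff neg scale zero)
qed

context module
begin

lemma rep_eval_linear: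
  assumes "\<And>g. module_hom scale scale (r g)"
  shows "module_hom scale scale (rep_eval scale r t)"
proof (induction t)
  case TZero
  show ?case by (simp add: module_hom_iff module_axioms)
next
  case (TScale c t)
  then show ?case
    by (simp add: module_hom_iff scale_right_distrib) (simp add: mult.commute)
next
  case (TGen g)
  show ?case using assms by simp
qed (simp_all add: module_hom_iff algebra_simps)

lemma rep_eval_cong:
  assumes lin: "\<And>g. module_hom scale scale (r g)"
    and R: "\<And>u v. (u, v) \<in> R \<Longrightarrow> rep_eval scale r u = rep_eval scale r v"
    and "lie_cong R x y"
  shows "rep_eval scale r x = rep_eval scale r y"
proof -
  have [simp]: "rep_eval scale r t (v + w) = rep_eval scale r t v + rep_eval scale r t w"
    "rep_eval scale r t (scale c v) = scale c (rep_eval scale r t v)" 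
    "rep_eval scale r t (v - w) = rep_eval scale r t v - rep_eval scale r t w"
    "rep_eval scale r t 0 = 0" for t v w c
    using module_hom_simps[OF rep_eval_linear[of r t, OF lin]] by auto
  show ?thesis
    using assms(3) by induction (simp_all add: R algebra_simps fun_eq_iff)
qed

lemma coc_eval_cong:
  assumes lin: "\<And>g. module_hom scale scale (r g)"
    and R: "\<And>u v. (u, v) \<in> R \<Longrightarrow> rep_eval scale r u = rep_eval scale r v"
    and Rd: "\<And>u v. (u, v) \<in> R \<Longrightarrow> coc_eval scale r d u = coc_eval scale r d v"
    and "lie_cong R x y"
  shows "coc_eval scale r d x = coc_eval scale r d y"
proof -
  have [simp]: "rep_eval scale r t (v + w) = rep_eval scale r t v + rep_eval scale r t w"
    "rep_eval scale r t (scale c v) = scale c (rep_eval scale r t v)" 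
    "rep_eval scale r t (v - w) = rep_eval scale r t v - rep_eval scale r t w"
    "rep_eval scale r t 0 = 0" for t v w c
    using module_hom_simps[OF rep_eval_linear[of r t, OF lin]] by auto
  show ?thesis
    using assms(4)
  proof induction
    case (br x x' y y')
    then show ?case using rep_eval_cong[OF lin R] by simp
  qed (simp_all add: Rd algebra_simps)
qed

end

context lie_algebra
begin

lemma module_hom_bracket: "module_hom scale scale (lie_bracket x)"
  by (simp add: module_hom_iff module_axioms bracket_add_right bracket_scale_right)

text \<open>In the adjoint representation this turns the cocycle rule for \<open>TBr\<close> into
  the Leibniz rule.\<close>

lemma rep_eval_bracket: "rep_eval scale (\<lambda>g. lie_bracket (f g)) t v = \<lblot>lie_eval scale f t, v\<rblot>"
proof (induction t arbitrary: v)
  case (TBr x y)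
  show ?case by (simp only: rep_eval.simps lie_eval.simps TBr bracket_bracket_left)
qed (simp_all add: bracket_add_left bracket_scale_left)

end

section \<open>Centralizers of generators in free Lie algebras\<close>

text \<open>Functions on words are noncommutative formal power series in the generators:
  \<open>cons_op\<close> and \<open>snoc_op\<close> multiply by a generator on the left and on the
  right, and \<open>empty_word\<close> is the unit series.\<close>

definition word_scale :: "'k::comm_ring_1 \<Rightarrow> ('g list \<Rightarrow> 'k) \<Rightarrow> 'g list \<Rightarrow> 'k"
  where "word_scale c f w = c * f w"

interpretation word: module word_scale
  by standard (simp_all add: word_scale_def fun_eq_iff algebra_simps)

definition cons_op :: "'g \<Rightarrow> ('g list \<Rightarrow> 'k::comm_ring_1) \<Rightarrow> 'g list \<Rightarrow> 'k"
  where "cons_op g f w = (if w \<noteq> [] \<and> hd w = g then f (tl w) else 0)"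

definition snoc_op :: "'g \<Rightarrow> ('g list \<Rightarrow> 'k::comm_ring_1) \<Rightarrow> 'g list \<Rightarrow> 'k"
  where "snoc_op g f w = (if w \<noteq> [] \<and> last w = g then f (butlast w) else 0)"

definition empty_word :: "'g list \<Rightarrow> 'k::comm_ring_1"
  where "empty_word w = (if w = [] then 1 else 0)"

lemma module_hom_cons_op: "module_hom word_scale word_scale (cons_op g)"
  by (simp add: module_hom_iff word.module_axioms cons_op_def word_scale_def fun_eq_iff)

text \<open>An element acts by left multiplication with its series expansion, which is itself
  recovered as \<open>word_rep x empty_word\<close>.\<close>

lift_definition word_rep ::
  "('k::comm_ring_1, 'g) free_lie \<Rightarrow> ('g list \<Rightarrow> 'k) \<Rightarrow> 'g list \<Rightarrow> 'k"
  is "rep_eval word_scale cons_op"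
  by (rule word.rep_eval_cong[OF module_hom_cons_op]) simp_all

lemma word_rep_simps:
  "word_rep (free_gen g) f = cons_op g f"
  "word_rep 0 f = 0"
  "word_rep (x + y) f = word_rep x f + word_rep y f"
  "word_rep (free_scale c x) f = word_scale c (word_rep x f)"
  "word_rep \<lblot>x, y\<rblot> f = word_rep x (word_rep y f) - word_rep y (word_rep x f)"
  by (transfer, simp add: fun_eq_iff)+

lemma module_hom_word_rep: "module_hom word_scale word_scale (word_rep x)"
  by transfer (rule word.rep_eval_linear[OF module_hom_cons_op])

text \<open>Left and right multiplications commute by associativity. On a word of length one, whose
  first and last letter coincide, both sides vanish in the generator case.\<close>

lemma word_rep_snoc_op: "word_rep x (snoc_op g f) = snoc_op g (word_rep x f)"
proof (induction x arbitrary: f rule: free_lie_induct)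
  case (gen h)
  show ?case
  proof
    fix w show "word_rep (free_gen h) (snoc_op g f) w = snoc_op g (word_rep (free_gen h) f) w"
    proof (cases w)
      case (Cons a v)
      then show ?thesis by (cases v) (auto simp: word_rep_simps cons_op_def snoc_op_def)
    qed (simp add: word_rep_simps cons_op_def snoc_op_def)
  qed
next
  case (br x y)
  have "snoc_op g (f - f') = snoc_op g f - snoc_op g f'" for f f' :: "'a list \<Rightarrow> 'b"
    by (simp add: snoc_op_def fun_eq_iff)
  then show ?case by (simp only: word_rep_simps br)
qed (auto simp: word_rep_simps snoc_op_def word_scale_def fun_eq_iff)

text \<open>On powers of a single letter the expansion behaves as if all other letters were zero.
  That quotient is commutative, so brackets contribute nothing and only the linear coefficient
  \<open>a\<close> of \<open>g\<close> is left.\<close>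

lemma word_rep_replicate:
  "\<exists>a. \<forall>f n. word_rep x f (replicate n g) = (if n = 0 then 0 else a * f (replicate (n - 1) g))"
proof (induction x rule: free_lie_induct)
  case (gen h)
  have "word_rep (free_gen h) f (replicate n g) =
      (if n = 0 then 0 else (if h = g then 1 else 0) * f (replicate (n - 1) g))" for f n
    by (cases n) (auto simp: word_rep_simps cons_op_def)
  then show ?case by blast
next
  case zero
  show ?case by (rule exI[of _ 0]) (simp add: word_rep_simps)
next
  case (add x y)
  then obtain a b
    where "\<forall>f n. word_rep x f (replicate n g) = (if n = 0 then 0 else a * f (replicate (n - 1) g))"
      "\<forall>f n. word_rep y f (replicate n g) = (if n = 0 then 0 else b * f (replicate (n - 1) g))"
    by blast
  then show ?case by (intro exI[of _ "a + b"]) (simp add: word_rep_simps distrib_right)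
next
  case (scale c x)
  then obtain a
    where "\<forall>f n. word_rep x f (replicate n g) = (if n = 0 then 0 else a * f (replicate (n - 1) g))"
    by blast
  then show ?case
    by (intro exI[of _ "c * a"]) (simp add: word_rep_simps word_scale_def mult.assoc)
next
  case (br x y)
  then obtain a b
    where "\<forall>f n. word_rep x f (replicate n g) = (if n = 0 then 0 else a * f (replicate (n - 1) g))"
      "\<forall>f n. word_rep y f (replicate n g) = (if n = 0 then 0 else b * f (replicate (n - 1) g))"
    by blast
  then show ?case by (intro exI[of _ 0]) (simp add: word_rep_simps mult.left_commute)
qed

text \<open>Comparing coefficients of \<open>g # w\<close> moves a trailing \<open>g\<close> to the front, until the last letter is
  not \<open>g\<close>.\<close>

lemma word_centralizer:
  assumes "cons_op g f = snoc_op g f" and "\<not> set w \<subseteq> {g}"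
  shows "f w = 0"
proof -
  have shift: "f w = (if last (g # w) = g then f (butlast (g # w)) else 0)" for w
    using fun_cong[OF assms(1), of "g # w"] by (simp add: cons_op_def snoc_op_def)
  have rotate: "f (v @ [g]) = f (g # v)" for v
    using shift[of "v @ [g]"] by simp
  have *: "f (u @ [b] @ replicate n g) = 0" if "b \<noteq> g" for u b n
  proof (induction n arbitrary: u)
    case 0
    then show ?case using shift[of "u @ [b]"] that by simp
  next
    case (Suc n)
    have "f (u @ [b] @ replicate (Suc n) g) = f ((g # u) @ [b] @ replicate n g)"
      using rotate[of "u @ [b] @ replicate n g"] by (simp add: replicate_append_same)
    then show ?case using Suc[of "g # u"] by simp
  qed
  obtain u b n where "w = u @ [b] @ replicate n g" "b \<noteq> g"
    using assms(2)
  proof (induction w arbitrary: thesis rule: rev_induct)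
    case (snoc a w)
    show ?case
    proof (cases "a = g")
      case True
      then obtain u b n where "w = u @ [b] @ replicate n g" "b \<noteq> g" using snoc by auto
      then show ?thesis using snoc.prems(1)[of u b "Suc n"] True
        by (simp add: replicate_append_same[symmetric])
    next
      case False
      then show ?thesis using snoc.prems(1)[of w a 0] by simp
    qed
  qed simp
  then show ?thesis using * by simp
qed

section \<open>Right-normed brackets and the Dynkin operator\<close>

fun word_bracket :: "'g list \<Rightarrow> ('k::comm_ring_1, 'g) free_lie"
  where
    "word_bracket [] = 0"
  | "word_bracket [g] = free_gen g"
  | "word_bracket (g # w) = \<lblot>free_gen g, word_bracket w\<rblot>"

definition dynkin :: "nat \<Rightarrow> ('g::finite list \<Rightarrow> 'k::comm_ring_1) \<Rightarrow> ('k, 'g) free_lie"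
  where "dynkin n f = (\<Sum>w | length w = n. free_scale (f w) (word_bracket w))"

lemma finite_words: "finite {w :: 'g::finite list. length w = n}"
  using finite_lists_length_eq[of "UNIV :: 'g set" n] by simp

lemma dynkin_simps:
  "dynkin n 0 = 0"
  "dynkin n (f + f') = dynkin n f + dynkin n f'"
  "dynkin n (f - f') = dynkin n f - dynkin n f'"
  "dynkin n (word_scale c f) = free_scale c (dynkin n f)"
  by (simp_all add: dynkin_def free_lie.scale_left_distrib free_lie.scale_left_diff_distrib
      sum.distrib sum_subtractf free_lie.scale_sum_right word_scale_def)

text \<open>Degree 0 is excluded because \<open>word_bracket [g]\<close> is
  \<open>free_gen g\<close> and not a bracket with \<open>word_bracket []\<close>.\<close>

lemma dynkin_cons_op:
  assumes "n > 0"
  shows "dynkin (Suc n) (cons_op g f) = \<lblot>free_gen g, dynkin n f\<rblot>"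
proof -
  have "dynkin (Suc n) (cons_op g f) =
      (\<Sum>w\<in>Cons g ` {w. length w = n}. free_scale (cons_op g f w) (word_bracket w))"
    unfolding dynkin_def
  proof (rule sum.mono_neutral_right[OF finite_words])
    show "\<forall>w\<in>{w. length w = Suc n} - Cons g ` {w. length w = n}.
        free_scale (cons_op g f w) (word_bracket w) = 0"
      by (auto simp: cons_op_def length_Suc_conv image_iff)
  qed auto
  also have "\<dots> = (\<Sum>w | length w = n. free_scale (f w) \<lblot>free_gen g, word_bracket w\<rblot>)"
  proof (subst sum.reindex)
    show "(\<Sum>w | length w = n. ((\<lambda>w. free_scale (cons_op g f w) (word_bracket w)) \<circ> Cons g) w) =
      (\<Sum>w | length w = n. free_scale (f w) \<lblot>free_gen g, word_bracket w\<rblot>)"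
    proof (rule sum.cong[OF HOL.refl])
      fix w :: "'b list"
      assume "w \<in> {w. length w = n}"
      then obtain a v where "w = a # v" using assms by (cases w) auto
      then show "((\<lambda>w. free_scale (cons_op g f w) (word_bracket w)) \<circ> Cons g) w =
        free_scale (f w) \<lblot>free_gen g, word_bracket w\<rblot>"
        by (simp add: cons_op_def)
    qed
  qed (rule inj_onI, simp)
  also have "\<dots> = \<lblot>free_gen g, dynkin n f\<rblot>"
    by (simp add: dynkin_def bracket_sum_right free_lie.bracket_scale_right)
  finally show ?thesis .
qed

lemma homogeneous_0: "homogeneous n x \<Longrightarrow> n = 0 \<Longrightarrow> x = 0"
  by (induction rule: homogeneous.induct) auto

text \<open>The operator turns left multiplication by \<open>x\<close> into the adjoint action of
  \<open>x\<close>. Both are compatible with commutators, so the case of generators,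
  \<open>dynkin_cons_op\<close>, carries the proof.\<close>

lemma dynkin_word_rep:
  "homogeneous m x \<Longrightarrow> n > 0 \<Longrightarrow> dynkin (m + n) (word_rep x f) = \<lblot>x, dynkin n f\<rblot>"
proof (induction arbitrary: f n rule: homogeneous.induct)
  case (br m x l y)
  have "dynkin (m + l + n) (word_rep x (word_rep y f)) = \<lblot>x, \<lblot>y, dynkin n f\<rblot>\<rblot>"
    using br.IH(1)[of "l + n" "word_rep y f"] br.IH(2)[of n f] br.prems by (simp add: add.assoc)
  moreover have "dynkin (m + l + n) (word_rep y (word_rep x f)) = \<lblot>y, \<lblot>x, dynkin n f\<rblot>\<rblot>"
    using br.IH(2)[of "m + n" "word_rep x f"] br.IH(1)[of n f] br.prems
    by (simp add: ac_simps)
  ultimately show ?case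
    by (simp only: word_rep_simps dynkin_simps bracket_bracket_left)
qed (simp_all add: word_rep_simps dynkin_simps dynkin_cons_op bracket_add_left
      free_lie.bracket_scale_left)

text \<open>For a bracket, the product xy contributes n[x,y] and the product yx contributes m[y,x]
  by \<open>dynkin_word_rep\<close>; their difference is (m + n)[x,y].\<close>

lemma dynkin_homogeneous:
  "homogeneous n x \<Longrightarrow> dynkin n (word_rep x empty_word) = free_scale (of_nat n) x"
proof (induction rule: homogeneous.induct)
  case (gen g)
  have "dynkin 1 (cons_op g empty_word :: _ \<Rightarrow> 'a) =
      (\<Sum>w\<in>{[g]}. free_scale (cons_op g empty_word w) (word_bracket w))"
    unfolding dynkin_def
    by (rule sum.mono_neutral_right[OF finite_words])
      (auto simp: cons_op_def length_Suc_conv)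
  moreover have "cons_op g empty_word [g] = (1 :: 'a)" by (simp add: cons_op_def empty_word_def)
  ultimately show ?case by (simp add: word_rep_simps)
next
  case (br m x n y)
  show ?case
  proof (cases "m = 0 \<or> n = 0")
    case True
    then have "x = 0 \<or> y = 0" using br.hyps homogeneous_0 by blast
    then show ?thesis
      by (auto simp: word_rep_simps dynkin_def module_hom_simps(3)[OF module_hom_word_rep])
  next
    case False
    then have "dynkin (m + n) (word_rep x (word_rep y empty_word)) = free_scale (of_nat n) \<lblot>x, y\<rblot>"
      "dynkin (n + m) (word_rep y (word_rep x empty_word)) = free_scale (of_nat m) \<lblot>y, x\<rblot>"
      using br by (simp_all add: dynkin_word_rep free_lie.bracket_scale_right)
    moreover have "\<lblot>y, x\<rblot> = - \<lblot>x, y\<rblot>" by (rule bracket_anticommute)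
    ultimately have "dynkin (m + n) (word_rep \<lblot>x, y\<rblot> empty_word) =
        free_scale (of_nat n) \<lblot>x, y\<rblot> + free_scale (of_nat m) \<lblot>x, y\<rblot>"
      by (simp only: word_rep_simps dynkin_simps add.commute[of n m]
          free_lie.scale_minus_right diff_minus_eq_add)
    then show ?thesis by (simp add: free_lie.scale_left_distrib add.commute)
  qed
next
  case (scale n x c)
  then show ?case
    by (simp only: word_rep_simps dynkin_simps free_lie.scale_scale mult.commute)
qed (simp_all only: word_rep_simps dynkin_simps free_lie.scale_right_distrib free_lie.scale_zero_right)

lemma homogeneous_support:
  "homogeneous n x \<Longrightarrow> (\<And>w. length w \<noteq> m \<Longrightarrow> f w = 0) \<Longrightarrow> length w \<noteq> n + m \<Longrightarrow> word_rep x f w = 0"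
proof (induction arbitrary: f m w rule: homogeneous.induct)
  case (gen g)
  then show ?case by (cases w) (auto simp: word_rep_simps cons_op_def)
next
  case (br k x l y)
  have "word_rep x (word_rep y f) w = 0"
    using br.prems by (intro br.IH(1)[of "l + m"] br.IH(2)[of m]) auto
  moreover have "word_rep y (word_rep x f) w = 0"
    using br.prems by (intro br.IH(2)[of "k + m"] br.IH(1)[of m]) auto
  ultimately show ?case by (simp add: word_rep_simps)
next
  case (add n x y)
  then have "word_rep x f w = 0" "word_rep y f w = 0" by blast+
  then show ?case by (simp add: word_rep_simps)
next
  case (scale n x c)
  then have "word_rep x f w = 0" by blast
  then show ?case by (simp add: word_rep_simps word_scale_def)
qed (simp add: word_rep_simps)

text \<open>Positivity of the degrees is what allows the factor \<open>of_nat n\<close> in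
  \<open>dynkin_homogeneous\<close> to be inverted.\<close>

lemma span_homogeneous: "x \<in> free_lie.span {x. \<exists>n>0. homogeneous n x}"
proof (induction x rule: free_lie_induct)
  case (gen g)
  show ?case by (rule free_lie.span_base) (auto intro: homogeneous.gen)
next
  case (br x y)
  have 1: "\<lblot>u, v\<rblot> \<in> free_lie.span {x. \<exists>n>0. homogeneous n x}"
    if "v \<in> free_lie.span {x. \<exists>n>0. homogeneous n x}" "homogeneous n u" "n > 0"
    for n and u v :: "('k::comm_ring_1, 'g) free_lie"
    using that(1)
  proof (induction rule: free_lie.span_induct_alt)
    case (step c x y)
    then obtain m where "m > 0" "homogeneous m x" by blast
    then have "\<lblot>u, x\<rblot> \<in> free_lie.span {x. \<exists>n>0. homogeneous n x}"
      using that by (intro free_lie.span_base) (auto intro!: exI[of _ "n + m"] homogeneous.br)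
    then show ?case
      using step by (simp add: bracket_add_right free_lie.bracket_scale_right free_lie.span_add free_lie.span_scale)
  qed (simp add: free_lie.span_zero)
  show ?case using br(1)
  proof (induction rule: free_lie.span_induct_alt)
    case (step c x z)
    then show ?case using 1[OF br(2)]
      by (auto simp add: bracket_add_left free_lie.bracket_scale_left intro!: free_lie.span_add free_lie.span_scale)
  qed (simp add: free_lie.span_zero)
qed (auto intro: free_lie.span_add free_lie.span_scale free_lie.span_zero)

text \<open>The rational scalars enter here: these inverses normalize the Dynkin operator to a
  projection.\<close>

lemma ex_inverse_of_nat:
  assumes "n > 0"
  shows "\<exists>r :: 'k::comm_rat_algebra. r * of_nat n = 1"
proof -
  obtain h :: "rat \<Rightarrow> 'k" where h: "h 1 = 1" "\<And>x y. h (x + y) = h x + h y" "\<And>x y. h (x * y) = h x * h y"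
    using ex_rat_hom by blast
  have "h 0 = 0" using h(2)[of 0 0] by simp
  then have "h (of_nat n) = of_nat n" for n by (induction n) (simp_all add: h)
  then have "h (1 / of_nat n) * of_nat n = h (1 / of_nat n * of_nat n)" by (metis h(3))
  then have "h (1 / of_nat n) * of_nat n = 1" using assms h(1) by simp
  then show ?thesis by blast
qed

text \<open>The Dynkin-Specht-Wever identity \<open>dynkin_homogeneous\<close> recovers \<open>x\<close> from its word expansion.\<close>

lemma word_rep_eq_0:
  fixes x :: "('k::comm_rat_algebra, 'g::finite) free_lie"
  assumes "word_rep x empty_word = 0"
  shows "x = 0"
proof -
  define r :: "nat \<Rightarrow> 'k" where "r n = (SOME r. r * of_nat n = 1)" for n
  have r: "r n * of_nat n = 1" if "n > 0" for n
    unfolding r_def by (rule someI_ex) (rule ex_inverse_of_nat[OF that])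
  \<comment> \<open>\<open>\<Phi> M\<close> sums the normalized Dynkin operators in degrees below
    \<open>M\<close>. On a homogeneous element a single degree contributes, so the value stabilizes
    at the element itself once \<open>M\<close> is large.\<close>
  define \<Phi> where "\<Phi> M x = (\<Sum>n<M. free_scale (r n) (dynkin n (word_rep x empty_word)))"
    for M and x :: "('k, 'g) free_lie"
  have "\<exists>N. \<forall>M\<ge>N. \<Phi> M x = x"
    using span_homogeneous[of x]
  proof (induction rule: free_lie.span_induct_alt)
    case base
    show ?case by (simp add: \<Phi>_def word_rep_simps dynkin_simps)
  next
    case (step c x y)
    then obtain N n where N: "\<And>M. M \<ge> N \<Longrightarrow> \<Phi> M y = y" and n: "n > 0" "homogeneous n x" by blast
    have "\<Phi> M x = x" if "M > n" for M
    proof -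
      have "dynkin m (word_rep x empty_word) = 0" if "m \<noteq> n" for m
        unfolding dynkin_def
        using homogeneous_support[OF n(2), of 0 empty_word] that
        by (intro sum.neutral) (auto simp: empty_word_def)
      then have "\<Phi> M x = (\<Sum>m\<in>{n}. free_scale (r m) (dynkin m (word_rep x empty_word)))"
        unfolding \<Phi>_def using that by (intro sum.mono_neutral_right) auto
      then show ?thesis using n r by (simp add: dynkin_homogeneous)
    qed
    then have "\<Phi> M (free_scale c x + y) = free_scale c x + y" if "M \<ge> max N (Suc n)" for M
    proof -
      have "\<Phi> M (free_scale c x + y) = free_scale c (\<Phi> M x) + \<Phi> M y"
        by (simp add: \<Phi>_def word_rep_simps dynkin_simps free_lie.scale_right_distrib sum.distrib
            free_lie.scale_sum_right mult.commute)
      then show ?thesis using that N \<open>\<And>M. n < M \<Longrightarrow> \<Phi> M x = x\<close> by simp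
    qed
    then show ?case by blast
  qed
  then obtain N where "\<Phi> N x = x" by blast
  then show ?thesis using assms by (simp add: \<Phi>_def dynkin_simps)
qed

text \<open>Commuting with \<open>g\<close> says that the expansion of \<open>x\<close> has equal
  left and right products with \<open>g\<close>. Its support then consists of powers of
  \<open>g\<close> by \<open>word_centralizer\<close>, and among these
  \<open>word_rep_replicate\<close> leaves only \<open>[g]\<close>; injectivity of the expansion
  concludes.\<close>

theorem centralizer_free_gen:
  fixes x :: "('k::comm_rat_algebra, 'g::finite) free_lie"
  assumes "\<lblot>free_gen g, x\<rblot> = 0"
  shows "\<exists>a. x = free_scale a (free_gen g)"
proof -
  let ?f = "word_rep x empty_word"
  have "word_rep \<lblot>free_gen g, x\<rblot> empty_word = 0" using assms by (simp add: word_rep_simps)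
  \<comment> \<open>The series \<open>g\<close> is also a right multiple of the unit, so the product
    of \<open>x\<close> and \<open>g\<close> becomes \<open>snoc_op g\<close> applied to the
    expansion of \<open>x\<close>.\<close>
  moreover have "cons_op g empty_word = (snoc_op g empty_word :: _ \<Rightarrow> 'k)"
    by (auto simp: cons_op_def snoc_op_def empty_word_def fun_eq_iff neq_Nil_conv)
  ultimately have comm: "cons_op g ?f = snoc_op g ?f"
    by (simp add: word_rep_simps word_rep_snoc_op)
  obtain a where a: "\<And>n. ?f (replicate n g) =
      (if n = 0 then 0 else a * empty_word (replicate (n - 1) g))"
    using word_rep_replicate[of x g] by blast
  have "?f w = word_rep (free_scale a (free_gen g)) empty_word w" for w
  proof (cases "set w \<subseteq> {g}")
    case True
    then have "w = replicate (length w) g" by (simp add: replicate_length_same subset_iff)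
    then show ?thesis using a[of "length w"]
      by (cases w) (auto simp: word_rep_simps cons_op_def word_scale_def empty_word_def)
  next
    case False
    then have "w \<noteq> [g]" by auto
    then have "word_rep (free_scale a (free_gen g)) empty_word w = 0"
      by (cases w) (auto simp: word_rep_simps cons_op_def word_scale_def empty_word_def)
    then show ?thesis using word_centralizer[OF comm False] by simp
  qed
  then have "word_rep (x - free_scale a (free_gen g)) empty_word = 0"
    using word_rep_simps(3)[of "x - free_scale a (free_gen g)" "free_scale a (free_gen g)" empty_word]
    by (simp add: fun_eq_iff)
  then show ?thesis using word_rep_eq_0 by fastforce
qed

instance letter :: finite
proof
  have "UNIV = {L0, L1}" using letter.exhaust by blast
  then show "finite (UNIV :: letter set)" by (metis finite.simps)
qed

section \<open>Linear parts\<close>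

lemma (in module) module_hom_zero: "module_hom scale scale (\<lambda>v. 0)"
  by (simp add: module_hom_iff module_axioms)

lemma (in module) rep_eval_zero: "rep_eval scale (\<lambda>g v. 0) t = (\<lambda>v. 0)"
  by (induction t) simp_all

lift_definition lin :: "('k::comm_ring_1, 'g) free_lie \<Rightarrow> ('k, 'g) free_lie"
  is "coc_eval free_scale (\<lambda>g v. 0) free_gen"
  by (rule free_lie.coc_eval_cong[OF free_lie.module_hom_zero]) simp_all

lift_definition lin_dk :: "('k::comm_ring_1, 'n) dk \<Rightarrow> ('k, 'n) dk"
  is "coc_eval dk_scale (\<lambda>g v. 0) (case_prod tt)"
  by (rule dk.coc_eval_cong[OF dk.module_hom_zero])
    (auto simp: dk_rels_def dk.rep_eval_zero t_commute)

lemma lin_simps [simp]: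
  "lin (free_gen g) = free_gen g" "lin 0 = 0" "lin (x + y) = lin x + lin y"
  "lin (free_scale c x) = free_scale c (lin x)" "lin \<lblot>x, y\<rblot> = 0"
  subgoal by transfer simp
  subgoal by transfer simp
  subgoal by transfer simp
  subgoal by transfer simp
  subgoal by transfer (simp add: free_lie.rep_eval_zero)
  done

lemma lin_minus [simp]: "lin (- x) = - lin x" "lin (x - y) = lin x - lin y"
proof -
  show *: "lin (- x) = - lin x" for x :: "('a, 'b) free_lie"
    using lin_simps(3)[of "- x" x] by (simp add: eq_neg_iff_add_eq_0)
  show "lin (x - y) = lin x - lin y" using lin_simps(3)[of x "- y"] * by simp
qed

lemma lin_dk_simps [simp]:
  "lin_dk (tt i j) = tt i j" "lin_dk 0 = 0" "lin_dk (x + y) = lin_dk x + lin_dk y"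
  "lin_dk (dk_scale c x) = dk_scale c (lin_dk x)" "lin_dk \<lblot>x, y\<rblot> = 0"
  subgoal by transfer simp
  subgoal by transfer simp
  subgoal by transfer simp
  subgoal by transfer simp
  subgoal by transfer (simp add: dk.rep_eval_zero)
  done

lemma lin_dk_minus [simp]: "lin_dk (- x) = - lin_dk x" "lin_dk (x - y) = lin_dk x - lin_dk y"
proof -
  show *: "lin_dk (- x) = - lin_dk x" for x :: "('a, 'b) dk"
    using lin_dk_simps(3)[of "- x" x] by (simp add: eq_neg_iff_add_eq_0)
  show "lin_dk (x - y) = lin_dk x - lin_dk y" using lin_dk_simps(3)[of x "- y"] * by simp
qed

lemma lin_e [simp]: "lin e0 = e0" "lin e1 = e1" "lin einf = einf"
  by (simp_all add: e0_def e1_def einf_def)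

lemma lin_lin [simp]: "lin (lin x) = lin x"
  by (induction x rule: free_lie_induct) simp_all

lemma lie2_induct [case_names e0 e1 zero add scale br]:
  assumes "P e0" "P e1" "P 0" "\<And>x y. P x \<Longrightarrow> P y \<Longrightarrow> P (x + y)"
    "\<And>c x. P x \<Longrightarrow> P (free_scale c x)" "\<And>x y. P x \<Longrightarrow> P y \<Longrightarrow> P \<lblot>x, y\<rblot>"
  shows "P (z :: 'k::comm_ring_1 lie2)"
proof (induction z rule: free_lie_induct)
  case (gen g)
  show ?case using assms(1,2) by (cases g) (simp_all add: e0_def e1_def)
qed (use assms in auto)

lemma lin_lie2: "\<exists>a b. lin C = free_scale a e0 + free_scale b (e1 :: 'k::comm_ring_1 lie2)"
proof (induction C rule: lie2_induct)
  case e0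
  show ?case by (intro exI[of _ 1] exI[of _ 0]) simp
next
  case e1
  show ?case by (intro exI[of _ 0] exI[of _ 1]) simp
next
  case (add x y)
  then obtain a b c d where "lin x = free_scale a e0 + free_scale b e1"
    "lin y = free_scale c e0 + free_scale d e1" by blast
  then show ?case
    by (intro exI[of _ "a + c"] exI[of _ "b + d"]) (simp add: free_lie.scale_left_distrib)
next
  case (scale r x)
  then obtain a b where "lin x = free_scale a e0 + free_scale b e1" by blast
  then show ?case
    by (intro exI[of _ "r * a"] exI[of _ "r * b"]) (simp add: free_lie.scale_right_distrib)
qed (auto intro!: exI[of _ 0])

lemma homogeneous_lin: "homogeneous n x \<Longrightarrow> n > 1 \<Longrightarrow> lin x = 0"
  by (induction rule: homogeneous.induct) simp_all

lemma homogeneous_decomp: "x - lin x \<in> free_lie.span {x. \<exists>n>1. homogeneous n x}"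
proof -
  have hom: "u - lin u \<in> free_lie.span {x. \<exists>n>1. homogeneous n x}" if "homogeneous n u" for n u
    using that
  proof (induction rule: homogeneous.induct)
    case (add n x y)
    then have "(x - lin x) + (y - lin y) \<in> free_lie.span {x. \<exists>n>1. homogeneous n x}"
      using free_lie.span_add by blast
    then show ?case by (simp add: algebra_simps)
  next
    case (scale n x c)
    then have "free_scale c (x - lin x) \<in> free_lie.span {x. \<exists>n>1. homogeneous n x}"
      using free_lie.span_scale by blast
    then show ?case by (simp add: algebra_simps)
  next
    case (br m x n y)
    show ?case
    proof (cases "m = 0 \<or> n = 0")
      case True
      then have "x = 0 \<or> y = 0" using br.hyps homogeneous_0 by blast
      then show ?thesis by (auto simp: free_lie.span_zero)
    next
      case False
      then have "\<lblot>x, y\<rblot> \<in> {x. \<exists>n>1. homogeneous n x}"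
        using homogeneous.br[OF br.hyps] by (auto intro!: exI[of _ "m + n"])
      then show ?thesis by (simp add: free_lie.span_base)
    qed
  qed (simp_all add: free_lie.span_zero)
  show ?thesis
    using span_homogeneous[of x]
  proof (induction rule: free_lie.span_induct_alt)
    case (step c x y)
    then have "free_scale c (x - lin x) + (y - lin y) \<in> free_lie.span {x. \<exists>n>1. homogeneous n x}"
      using hom free_lie.span_add free_lie.span_scale by blast
    then show ?case by (simp add: algebra_simps)
  qed (simp add: free_lie.span_zero)
qed

text \<open>This replaces the span in the definition of \<open>frakG\<close> by an equation that can
  be checked by rewriting.\<close>

lemma frakG_iff: "C \<in> frakG \<longleftrightarrow> lin C = 0"
proof
  assume "C \<in> frakG"
  then show "lin C = 0"
    unfolding frakG_def
  proof (induction rule: free_lie.span_induct_alt)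
    case (step c x y)
    then have "lin x = 0" using homogeneous_lin by blast
    with step show ?case by simp
  qed simp
next
  assume "lin C = 0"
  then show "C \<in> frakG" using homogeneous_decomp[of C] by (simp add: frakG_def)
qed

section \<open>Substitutions\<close>

context lie_algebra
begin

lemma subst2_simps [simp]:
  "subst2 scale e0 a b = a" "subst2 scale e1 a b = b" "subst2 scale 0 a b = 0"
  "subst2 scale (x + y) a b = subst2 scale x a b + subst2 scale y a b"
  "subst2 scale (- x) a b = - subst2 scale x a b"
  "subst2 scale (x - y) a b = subst2 scale x a b - subst2 scale y a b"
  "subst2 scale (free_scale c x) a b = scale c (subst2 scale x a b)"
  "subst2 scale \<lblot>x, y\<rblot> a b = \<lblot>subst2 scale x a b, subst2 scale y a b\<rblot>"
  by (simp_all add: subst2_def e0_def e1_def lie_homD[OF lie_hom_free_subst])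

lemma subst2_einf [simp]: "subst2 scale einf a b = - a - b"
  by (simp add: einf_def)

lemma bracket_subst2_0:
  assumes "\<lblot>z, a\<rblot> = 0" "\<lblot>z, b\<rblot> = 0"
  shows "\<lblot>z, subst2 scale C a b\<rblot> = 0"
  by (induction C rule: lie2_induct)
    (simp_all add: assms bracket_add_right bracket_scale_right bracket_bracket_right)

lemma subst2_lin_commute:
  assumes "\<lblot>z, u\<rblot> = 0" "\<lblot>w, u\<rblot> = 0"
  shows "\<lblot>subst2 scale (lin C) z w, u\<rblot> = 0"
  by (rule bracket_eq_0_commute, rule bracket_subst2_0) (simp_all add: assms bracket_eq_0_commute)

text \<open>Since \<open>z\<close> and \<open>w\<close> commute with each other and with
  \<open>a\<close> and \<open>b\<close>, they disappear from every bracket and survive only through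
  the linear part of \<open>C\<close>. This is the device for discarding central summands of
  arguments.\<close>

lemma subst2_shift:
  assumes "\<lblot>z, a\<rblot> = 0" "\<lblot>z, b\<rblot> = 0" "\<lblot>w, a\<rblot> = 0" "\<lblot>w, b\<rblot> = 0" "\<lblot>z, w\<rblot> = 0"
  shows "subst2 scale C (a + z) (b + w) = subst2 scale C a b + subst2 scale (lin C) z w"
proof (induction C rule: lie2_induct)
  case (br x y)
  have comm: "\<lblot>subst2 scale (lin u) z w, subst2 scale v a b\<rblot> = 0"
    "\<lblot>subst2 scale v a b, subst2 scale (lin u) z w\<rblot> = 0"
    "\<lblot>subst2 scale (lin u) z w, subst2 scale (lin v) z w\<rblot> = 0" for u v
    using assms
    by (auto intro!: subst2_lin_commute bracket_subst2_0 intro: bracket_eq_0_commute simp: bracket_self)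
  show ?case by (simp add: br bracket_distribs comm)
qed (simp_all add: algebra_simps)

lemma subst2_0_0 [simp]: "subst2 scale C 0 0 = 0"
  by (induction C rule: lie2_induct) simp_all

lemma subst2_lin0:
  assumes "lin C = 0"
  shows "subst2 scale C 0 b = 0" "subst2 scale C a 0 = 0" 
  using subst2_shift[of 0 0 0 b C] subst2_shift[of a 0 0 0 C] assms by simp_all

end

lemma subst2_hom:
  assumes "lie_hom s s' f" "lie_algebra s" "lie_algebra s'"
  shows "f (subst2 s C a b) = subst2 s' C (f a) (f b)"
proof -
  interpret s: lie_algebra s by fact
  interpret s': lie_algebra s' by fact
  show ?thesis
    by (induction C rule: lie2_induct) (simp_all add: lie_homD[OF assms(1)])
qed

lemma subst2_subst2:
  "lie_algebra s \<Longrightarrow> subst2 s (subst_lie2 C x y) a b = subst2 s C (subst2 s x a b) (subst2 s y a b)"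
  for s :: "'k::comm_ring_1 \<Rightarrow> 'a::lie_ring \<Rightarrow> 'a"
  by (rule subst2_hom[of _ _ "\<lambda>C. subst2 s C a b"])
     (simp_all add: subst2_def lie_algebra.lie_hom_free_subst free_lie.lie_algebra_axioms)

lemmas subst_lie2_subst_lie2 = subst2_subst2[OF free_lie.lie_algebra_axioms]
lemmas subst_dk_subst_lie2 = subst2_subst2[OF dk.lie_algebra_axioms]

lemma subst_lie2_id [simp]: "subst_lie2 C e0 e1 = C"
  by (induction C rule: lie2_induct) simp_all

lemma lin_dk_subst:
  assumes "lin_dk a = a" "lin_dk b = b"
  shows "lin_dk (subst_dk C a b) = subst_dk (lin C) a b"
  by (induction C rule: lie2_induct) (simp_all add: assms)

lemma lin_subst:
  assumes "lin a = a" "lin b = b"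
  shows "lin (subst_lie2 C a b) = subst_lie2 (lin C) a b"
  by (induction C rule: lie2_induct) (simp_all add: assms)

text \<open>Sending \<open>e0\<close> to \<open>einf\<close> and fixing \<open>e1\<close> is an
  involution, which reduces the claim to the centralizer of the generator \<open>e0\<close>. A
  nonzero multiple of that generator is excluded by the linear part.\<close>

lemma centralizer_einf:
  fixes x :: "'k::comm_rat_algebra lie2"
  assumes "\<lblot>einf, x\<rblot> = 0" "lin x = 0"
  shows "x = 0"
proof -
  let ?y = "subst_lie2 x einf e1"
  have "\<lblot>free_gen L0, ?y\<rblot> = subst_lie2 \<lblot>einf, x\<rblot> einf e1"
    by (simp add: einf_def) (simp add: e0_def)
  then have "\<lblot>free_gen L0, ?y\<rblot> = 0" using assms by simp
  then obtain a where a: "?y = free_scale a e0"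
    using centralizer_free_gen unfolding e0_def by blast
  have "lin ?y = 0" using assms by (simp add: lin_subst)
  then have "?y = 0" using a by simp
  then have "subst_lie2 ?y einf e1 = 0" by simp
  then show ?thesis by (simp add: subst_lie2_subst_lie2)
     (simp add: einf_def)
qed

lemma h_of_eqI:
  assumes "h \<in> frakG" "\<lblot>C, e0\<rblot> + \<lblot>h, einf\<rblot> = 0"
  shows "h_of C = h"
  unfolding h_of_def
proof (rule the_equality)
  fix h' assume h': "h' \<in> frakG \<and> \<lblot>C, e0\<rblot> + \<lblot>h', einf\<rblot> = 0"
  then have "\<lblot>h' - h, einf\<rblot> = 0" using assms by (simp add: bracket_diff_left add_eq_0_iff)
  then have "\<lblot>einf, h' - h\<rblot> = 0" by (rule bracket_eq_0_commute)
  moreover have "lin (h' - h) = 0" using h' assms by (simp add: frakG_iff)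
  ultimately have "h' - h = 0" by (rule centralizer_einf)
  then show "h' = h" by simp
qed (use assms in simp)

section \<open>Morphisms and derivations of \<open>\<tt>\<^sub>n\<close>\<close>

lemmas dk_pull_simps [simp] = lie_homD[OF lie_hom_dk_pull]

lemma dk_pull_subst_dk [simp]:
  "dk_pull \<phi> (subst_dk C a b) = subst_dk C (dk_pull \<phi> a) (dk_pull \<phi> b)"
  by (rule subst2_hom[OF lie_hom_dk_pull dk.lie_algebra_axioms dk.lie_algebra_axioms])

lemma lie_eval_tt: "lie_eval dk_scale (case_prod tt) t = abs_dk t"
  by (induction t) (auto simp: tt.abs_eq zero_dk_def plus_dk.abs_eq dk_scale.abs_eq lie_bracket_dk.abs_eq)

text \<open>A derivation is a 1-cocycle for the adjoint representation, so only the defining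
  relations have to be respected; \<open>rel3\<close> and \<open>rel4\<close> are their images under
  the Leibniz rule.\<close>

lemma ex_der_dk:
  fixes f :: "'n \<Rightarrow> 'n \<Rightarrow> ('k::comm_ring_1, 'n) dk"
  assumes self: "\<And>i. f i i = 0" and sym: "\<And>i j. f j i = f i j"
    and rel3: "\<And>i j k. distinct [i, j, k] \<Longrightarrow>
      \<lblot>f i j + f i k, tt j k\<rblot> + \<lblot>tt i j + tt i k, f j k\<rblot> = 0"
    and rel4: "\<And>i j k l. distinct [i, j, k, l] \<Longrightarrow> \<lblot>f i j, tt k l\<rblot> + \<lblot>tt i j, f k l\<rblot> = 0"
  shows "\<exists>D\<in>der dk_scale. \<forall>i j. D (tt i j) = f i j"
proof -
  let ?r = "\<lambda>g. lie_bracket (case_prod tt g :: ('k, 'n) dk)"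
  let ?d = "coc_eval dk_scale ?r (case_prod f)"
  define D where "D x = ?d (rep_dk x)" for x
  have r: "rep_eval dk_scale ?r t v = \<lblot>abs_dk t, v\<rblot>" for t v
    by (simp add: dk.rep_eval_bracket lie_eval_tt)
  have "?d t = ?d t'" if "lie_cong dk_rels t t'" for t t'
  proof (rule dk.coc_eval_cong[OF dk.module_hom_bracket _ _ that])
    fix u v :: "('k, 'n \<times> 'n) lie_term" assume uv: "(u, v) \<in> dk_rels"
    then have "abs_dk u = abs_dk v" by (simp add: dk.abs_eq_iff lie_cong.rel)
    then show "rep_eval dk_scale ?r u = rep_eval dk_scale ?r v" by (simp add: r fun_eq_iff)
    have anti: "\<lblot>a, b\<rblot> - \<lblot>c, d\<rblot> = \<lblot>a, b\<rblot> + \<lblot>d, c\<rblot>" for a b c d :: "('k, 'n) dk"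
      using bracket_anticommute[of d c] by simp
    show "?d u = ?d v"
      using uv
      by (auto simp: dk_rels_def self sym anti bracket_distribs[symmetric] dest: rel3 rel4)
        (metis add.commute rel3 rel4 distinct_length_2_or_more distinct_singleton)+
  qed
  then have D: "D (abs_dk t) = ?d t" for t
    unfolding D_def by (metis Quotient_dk Quotient_rep_abs lie_cong.refl)
  have ex: "\<exists>t. x = abs_dk t" for x :: "('k, 'n) dk"
    by (metis Quotient_abs_rep Quotient_dk)
  have "D (x + y) = D x + D y" "D (dk_scale c x) = dk_scale c (D x)"
    "D \<lblot>x, y\<rblot> = \<lblot>D x, y\<rblot> + \<lblot>x, D y\<rblot>" for x y c
    using ex[of x] ex[of y] bracket_anticommute[of "D x" y]
    by (auto simp: plus_dk.abs_eq dk_scale.abs_eq lie_bracket_dk.abs_eq D r)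
  then have "D \<in> der dk_scale" by (simp add: der_def module_hom_iff dk.module_axioms)
  moreover have "D (tt i j) = f i j" for i j by (simp add: tt.abs_eq D)
  ultimately show ?thesis by blast
qed

lemma dk_hom_eqI:
  assumes "lie_hom dk_scale s f" "lie_hom dk_scale s g" "\<And>i j. f (tt i j) = g (tt i j)"
  shows "f x = g x"
  by (induction x rule: dk_induct)
    (simp_all add: lie_homD[OF assms(1)] lie_homD[OF assms(2)] assms(3))

lemma dk_der_eqI:
  assumes "lie_hom dk_scale s f" "D \<in> der dk_scale" "D' \<in> der s"
    and "\<And>i j. D' (f (tt i j)) = f (D (tt i j))"
  shows "D' (f x) = f (D x)"
  by (induction x rule: dk_induct)
    (simp_all add: lie_homD[OF assms(1)] derD[OF assms(2)] derD[OF assms(3)] assms(4))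

lemma lie_hom_id: "lie_hom dk_scale dk_scale (\<lambda>x. x)"
  by (simp add: lie_hom_def module_hom_iff dk.module_axioms)

text \<open>All brackets among three strands are multiples of one of them. As rewrite rules these
  bring brackets into a normal form, and the checks of relations become linear.\<close>

lemma bracket_triple:
  assumes "distinct [i, j, k]"
  shows "\<lblot>tt i j, tt i k\<rblot> = \<lblot>tt i k, tt j k :: ('k::comm_ring_1, 'n) dk\<rblot>"
    "\<lblot>tt i j, tt j k\<rblot> = - \<lblot>tt i k, tt j k :: ('k::comm_ring_1, 'n) dk\<rblot>"
    "\<lblot>tt i k, tt i j\<rblot> = - \<lblot>tt i k, tt j k :: ('k::comm_ring_1, 'n) dk\<rblot>"
    "\<lblot>tt j k, tt i j\<rblot> = \<lblot>tt i k, tt j k :: ('k::comm_ring_1, 'n) dk\<rblot>"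
    "\<lblot>tt j k, tt i k\<rblot> = - \<lblot>tt i k, tt j k :: ('k::comm_ring_1, 'n) dk\<rblot>"
proof -
  note a = bracket_anticommute
  have 1: "\<lblot>tt i j, tt j k\<rblot> + \<lblot>tt i k, tt j k :: ('k, 'n) dk\<rblot> = 0"
    using t_rel3[of i j k] assms by (simp add: bracket_add_left)
  have 2: "\<lblot>tt i j, tt i k\<rblot> + \<lblot>tt j k, tt i k :: ('k, 'n) dk\<rblot> = 0"
    using t_rel3[of j i k] assms by (auto simp: bracket_add_left t_commute[of j i])
  show b: "\<lblot>tt i j, tt j k\<rblot> = - \<lblot>tt i k, tt j k :: ('k, 'n) dk\<rblot>"
    using 1 by (simp add: eq_neg_iff_add_eq_0)
  show c: "\<lblot>tt j k, tt i k\<rblot> = - \<lblot>tt i k, tt j k :: ('k, 'n) dk\<rblot>" by (rule a)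
  show d: "\<lblot>tt i j, tt i k\<rblot> = \<lblot>tt i k, tt j k :: ('k, 'n) dk\<rblot>" using 2 c by simp
  show "\<lblot>tt i k, tt i j\<rblot> = - \<lblot>tt i k, tt j k :: ('k, 'n) dk\<rblot>" by (subst a) (simp add: d)
  show "\<lblot>tt j k, tt i j\<rblot> = \<lblot>tt i k, tt j k :: ('k, 'n) dk\<rblot>" by (subst a) (simp add: b)
qed

lemma tt3_sort [simp]:
  "tt 2 (1::3) = tt 1 2" "tt 3 (1::3) = tt 1 3" "tt 3 (2::3) = tt 2 3"
  by (rule t_commute)+

lemma tt4_sort [simp]:
  "tt 2 (1::4) = tt 1 2" "tt 3 (1::4) = tt 1 3" "tt 3 (2::4) = tt 2 3"
  "tt 4 (1::4) = tt 1 4" "tt 4 (2::4) = tt 2 4" "tt 4 (3::4) = tt 3 4"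
  by (rule t_commute)+

lemma distinct3: "distinct [1, 2, 3 :: 3]" by simp
lemma distinct4: "distinct [1, 2, 3 :: 4]" "distinct [1, 2, 4 :: 4]" "distinct [1, 3, 4 :: 4]"
  "distinct [2, 3, 4 :: 4]" by simp_all

lemmas tt3_bracket = bracket_triple[OF distinct3]

lemma tt4_commute:
  "\<lblot>tt 1 2, tt 3 (4::4)\<rblot> = 0" "\<lblot>tt 3 4, tt 1 (2::4)\<rblot> = 0" "\<lblot>tt 1 3, tt 2 (4::4)\<rblot> = 0"
  "\<lblot>tt 2 4, tt 1 (3::4)\<rblot> = 0" "\<lblot>tt 1 4, tt 2 (3::4)\<rblot> = 0" "\<lblot>tt 2 3, tt 1 (4::4)\<rblot> = 0"
  by (rule t_rel4, simp)+

lemmas tt4_bracket = distinct4[THEN bracket_triple(1)] distinct4[THEN bracket_triple(2)]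
  distinct4[THEN bracket_triple(3)] distinct4[THEN bracket_triple(4)]
  distinct4[THEN bracket_triple(5)] tt4_commute

section \<open>Central elements and the quotient of t_3 by its center\<close>

definition c3 :: "('k::comm_ring_1, 3) dk" where "c3 = tt 1 2 + tt 1 3 + tt 2 3"
definition c4 :: "('k::comm_ring_1, 4) dk"
  where "c4 = tt 1 2 + tt 1 3 + tt 2 3 + tt 1 4 + tt 2 4 + tt 3 4"

lemma c3_central [simp]: "\<lblot>c3, x\<rblot> = 0" "\<lblot>x, c3\<rblot> = 0"
proof -
  show *: "\<lblot>c3, x\<rblot> = 0" for x :: "('a, 3) dk"
  proof (induction x rule: dk_induct)
    case (gen i j)
    show ?case using exhaust3[of i] exhaust3[of j]
      by (elim disjE) (simp_all add: c3_def bracket_distribs tt3_bracket bracket_self)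
  qed (simp_all add: bracket_add_right dk.bracket_scale_right bracket_bracket_right)
  show "\<lblot>x, c3\<rblot> = 0" by (rule bracket_eq_0_commute) (rule *)
qed

lemma c4_central [simp]: "\<lblot>c4, x\<rblot> = 0" "\<lblot>x, c4\<rblot> = 0"
proof -
  show *: "\<lblot>c4, x\<rblot> = 0" for x :: "('a, 4) dk"
  proof (induction x rule: dk_induct)
    case (gen i j)
    show ?case using exhaust4[of i] exhaust4[of j]
      by (elim disjE) (simp_all add: c4_def bracket_distribs tt4_bracket bracket_self)
  qed (simp_all add: bracket_add_right dk.bracket_scale_right bracket_bracket_right)
  show "\<lblot>x, c4\<rblot> = 0" by (rule bracket_eq_0_commute) (rule *)
qed

text \<open>The third generator is \<open>c3\<close> minus the other two, and the central
  \<open>c3\<close> drops out of all brackets.\<close>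

lemma t3_decomp:
  assumes "distinct [i, j, k]"
  obtains P m where "x = subst_dk P (tt i j) (tt i k) + dk_scale m (c3 :: ('k::comm_ring_1, 3) dk)"
proof -
  let ?I = "\<lambda>x. \<exists>P m. x = subst_dk P (tt i j) (tt i k) + dk_scale m (c3 :: ('k, 3) dk)"
  have e0: "?I (tt i j)" by (intro exI[of _ e0] exI[of _ 0]) simp
  have e1: "?I (tt i k)" by (intro exI[of _ e1] exI[of _ 0]) simp
  have "tt i j + tt i k + tt j k = (c3 :: ('k, 3) dk)"
    using assms exhaust3[of i] exhaust3[of j] exhaust3[of k]
    by (elim disjE) (simp_all add: c3_def algebra_simps)
  then have "tt j k = c3 - tt i j - (tt i k :: ('k, 3) dk)" by (simp add: algebra_simps)
  then have einf: "?I (tt j k)"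
    by (intro exI[of _ einf] exI[of _ 1]) simp
  have zero: "?I 0" by (intro exI[of _ 0]) simp
  have sym: "?I (tt b a)" if "?I (tt a b)" for a b
    by (subst t_commute) (rule that)
  have "?I x"
  proof (induction x rule: dk_induct)
    case zero
    show ?case by (fact zero)
  next
    case (gen a b)
    have "i = a \<or> j = a \<or> k = a" "i = b \<or> j = b \<or> k = b"
      using assms exhaust3[of i] exhaust3[of j] exhaust3[of k] exhaust3[of a] exhaust3[of b]
      by (elim disjE; simp)+
    then show ?case
      using zero e0 e1 einf sym[OF e0] sym[OF e1] sym[OF einf] by (elim disjE) (simp_all only: t_self)
  next
    case (add x y)
    then obtain P m Q n where "x = subst_dk P (tt i j) (tt i k) + dk_scale m c3"
      "y = subst_dk Q (tt i j) (tt i k) + dk_scale n c3" by blast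
    then show ?case
      by (intro exI[of _ "P + Q"] exI[of _ "m + n"]) (simp add: dk.scale_left_distrib)
  next
    case (scale c x)
    then obtain P m where "x = subst_dk P (tt i j) (tt i k) + dk_scale m c3" by blast
    then show ?case
      by (intro exI[of _ "free_scale c P"] exI[of _ "c * m"]) (simp add: dk.scale_right_distrib)
  next
    case (br x y)
    then obtain P m Q n where "x = subst_dk P (tt i j) (tt i k) + dk_scale m c3"
      "y = subst_dk Q (tt i j) (tt i k) + dk_scale n c3" by blast
    then show ?case
      by (intro exI[of _ "\<lblot>P, Q\<rblot>"] exI[of _ "0"])
        (simp add: bracket_distribs dk.bracket_scale_left dk.bracket_scale_right)
  qed
  then show ?thesis using that by blast
qed

lemma dk_rels_cases:
  assumes "(u, v) \<in> dk_rels"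
  obtains (1) i where "u = TGen (i, i)" "v = TZero"
    | (2) i j where "u = TGen (j, i)" "v = TGen (i, j)"
    | (3) i j k where "u = TBr (TAdd (TGen (i, j)) (TGen (i, k))) (TGen (j, k))" "v = TZero" "distinct [i, j, k]"
    | (4) i j k l where "u = TBr (TGen (i, j)) (TGen (k, l))" "v = TZero" "distinct [i, j, k, l]"
  using assms unfolding dk_rels_def by (elim UnE CollectE exE conjE; simp only: prod.inject)

definition ret3_gen :: "3 \<times> 3 \<Rightarrow> 'k::comm_ring_1 lie2"
  where "ret3_gen = (\<lambda>(i, j). if i = j then 0 else if i \<noteq> 1 \<and> j \<noteq> 1 then e0
    else if i \<noteq> 3 \<and> j \<noteq> 3 then e1 else einf)"

text \<open>With this the three-strand relation reads
  \<open>\<lblot>- x, x\<rblot> = 0\<close>.\<close>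

lemma ret3_gen_total: "distinct [i, j, k] \<Longrightarrow> ret3_gen (i, j) + ret3_gen (i, k) = - ret3_gen (j, k)"
  using exhaust3[of i] exhaust3[of j] exhaust3[of k]
  by (elim disjE) (simp_all add: ret3_gen_def einf_def)

lemma ret3_gen_rels:
  assumes "(u, v) \<in> dk_rels"
  shows "lie_eval free_scale ret3_gen u = lie_eval free_scale ret3_gen v"
  using assms
proof (cases rule: dk_rels_cases)
  case (3 i j k)
  then show ?thesis by (simp add: ret3_gen_total bracket_self)
next
  case (4 i j k l)
  then have False using exhaust3[of i] exhaust3[of j] exhaust3[of k] exhaust3[of l]
    by (elim disjE) simp_all
  then show ?thesis ..
next
  case (2 i j)
  have "ret3_gen (j, i) = ret3_gen (i, j)" by (simp add: ret3_gen_def conj_commute)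
  then show ?thesis by (simp only: 2 lie_eval.simps)
qed (simp add: ret3_gen_def)

lift_definition ret3 :: "('k::comm_ring_1, 3) dk \<Rightarrow> 'k lie2"
  is "lie_eval free_scale ret3_gen"
  by (rule free_lie.lie_eval_cong[OF _ ret3_gen_rels])

lemma lie_hom_ret3: "lie_hom dk_scale free_scale (ret3 :: ('k::comm_ring_1, 3) dk \<Rightarrow> 'k lie2)"
proof -
  have "ret3 (x + y) = ret3 x + ret3 y" "ret3 (dk_scale c x) = free_scale c (ret3 x)"
    "ret3 \<lblot>x, y\<rblot> = \<lblot>ret3 x, ret3 y\<rblot>" for x y :: "('k, 3) dk" and c
    by (transfer, simp)+
  then show ?thesis
    unfolding lie_hom_def module_hom_iff by (simp add: dk.module_axioms free_lie.module_axioms)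
qed

lemma ret3_tt [simp]: "ret3 (tt 1 2) = e1" "ret3 (tt 1 3) = einf" "ret3 (tt 2 3) = e0"
  by (transfer, simp add: ret3_gen_def)+

text \<open>\<open>ret3\<close> is the quotient of \<open>\<tt>\<^sub>3\<close> by its center, and \<open>kill a b c\<close> first removes the strand other
  than \<open>a\<close>, \<open>b\<close>, \<open>c\<close>.\<close>

definition kill :: "4 \<Rightarrow> 4 \<Rightarrow> 4 \<Rightarrow> ('k::comm_ring_1, 4) dk \<Rightarrow> 'k lie2"
  where "kill a b c x = ret3 (dk_pull [1 \<mapsto> a, 2 \<mapsto> b, 3 \<mapsto> c] x)"

lemma lie_hom_kill: "lie_hom dk_scale free_scale (kill a b c)"
  by (simp add: lie_hom_def module_hom_iff dk.module_axioms free_lie.module_axioms kill_def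
     lie_homD[OF lie_hom_ret3])

lemmas kill_simps [simp] = lie_homD[OF lie_hom_kill]

lemma kill_subst_dk [simp]: "kill a b c (subst_dk C x y) = subst_lie2 C (kill a b c x) (kill a b c y)"
  by (rule subst2_hom[OF lie_hom_kill dk.lie_algebra_axioms free_lie.lie_algebra_axioms])

lemma kill_tt [simp]:
  "kill 1 2 3 (tt 1 2) = e1" "kill 1 2 3 (tt 1 3) = einf" "kill 1 2 3 (tt 2 3) = e0"
  "kill 1 2 3 (tt 1 4) = 0" "kill 1 2 3 (tt 2 4) = 0" "kill 1 2 3 (tt 3 4) = 0"
  "kill 1 2 4 (tt 1 2) = e1" "kill 1 2 4 (tt 1 4) = einf" "kill 1 2 4 (tt 2 4) = e0"
  "kill 1 2 4 (tt 1 3) = 0" "kill 1 2 4 (tt 2 3) = 0" "kill 1 2 4 (tt 3 4) = 0"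
  "kill 1 3 4 (tt 1 3) = e1" "kill 1 3 4 (tt 1 4) = einf" "kill 1 3 4 (tt 3 4) = e0"
  "kill 1 3 4 (tt 1 2) = 0" "kill 1 3 4 (tt 2 3) = 0" "kill 1 3 4 (tt 2 4) = 0"
  "kill 2 3 4 (tt 2 3) = e1" "kill 2 3 4 (tt 2 4) = einf" "kill 2 3 4 (tt 3 4) = e0"
  "kill 2 3 4 (tt 1 2) = 0" "kill 2 3 4 (tt 1 3) = 0" "kill 2 3 4 (tt 1 4) = 0"
  by (simp_all add: kill_def dk_pull_t sum_Collect3 lie_homD[OF lie_hom_ret3])

lemma D_of:
  fixes C :: "'k::comm_rat_algebra lie2"
  assumes h: "\<lblot>C, e0\<rblot> + \<lblot>h_of C, einf\<rblot> = 0"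
  shows "D_of C \<in> der dk_scale" "D_of C (tt 1 2) = 0"
    "D_of C (tt 2 3) = \<lblot>subst_dk C (tt 2 3) (tt 1 2), tt 2 3\<rblot>"
    "D_of C (tt 1 3) = \<lblot>subst_dk (h_of C) (tt 2 3) (tt 1 2), tt 1 3\<rblot>"
proof -
  let ?c = "subst_dk C (tt 2 3) (tt 1 2) :: ('k, 3) dk"
  let ?h = "subst_dk (h_of C) (tt 2 3) (tt 1 2) :: ('k, 3) dk"
  let ?P = "\<lambda>D. D \<in> der dk_scale \<and> D (tt 1 2) = 0 \<and>
     D (tt 2 3) = \<lblot>?c, tt 2 3\<rblot> \<and> D (tt 1 3) = \<lblot>?h, tt 1 3\<rblot>"
  define f where "f i j = (if i = j then 0 else if i \<noteq> 1 \<and> j \<noteq> 1 then \<lblot>?c, tt 2 3\<rblot>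
    else if i \<noteq> 3 \<and> j \<noteq> 3 then 0 else \<lblot>?h, tt 1 3\<rblot>)" for i j :: 3
  have "subst_dk (\<lblot>C, e0\<rblot> + \<lblot>h_of C, einf\<rblot>) (tt 2 3) (tt 1 2) = (0 :: ('k, 3) dk)" using h by simp
  \<comment> \<open>The image of \<open>einf\<close> is t_13 only up to the central element
    \<open>c3\<close>, which does not affect brackets.\<close>
  moreover have "- tt 2 3 - tt 1 2 = tt 1 3 - (c3 :: ('k, 3) dk)" by (simp add: c3_def algebra_simps)
  ultimately have sum0: "\<lblot>?c, tt 2 3\<rblot> + \<lblot>?h, tt 1 3\<rblot> = 0" by (simp add: bracket_diff_right)
  have total: "f i j + f i k + f j k = 0" if "distinct [i, j, k]" for i j k
    using that exhaust3[of i] exhaust3[of j] exhaust3[of k] sum0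
    by (elim disjE) (simp_all add: f_def add.commute)
  have c3: "tt i j + tt i k + tt j k = (c3 :: ('k, 3) dk)" if "distinct [i, j, k]" for i j k
    using that exhaust3[of i] exhaust3[of j] exhaust3[of k]
    by (elim disjE) (simp_all add: c3_def algebra_simps)
  have "\<exists>D\<in>der dk_scale. \<forall>i j. D (tt i j) = f i j"
  proof (rule ex_der_dk)
    fix i j k :: 3 assume d: "distinct [i, j, k]"
    have "f i j + f i k = - f j k" using total[OF d] by (simp add: eq_neg_iff_add_eq_0)
    moreover have "tt i j + tt i k = c3 - (tt j k :: ('k, 3) dk)"
      using c3[OF d] by (simp add: algebra_simps)
    ultimately show "\<lblot>f i j + f i k, tt j k\<rblot> + \<lblot>tt i j + tt i k, f j k\<rblot> = 0"
      using bracket_anticommute[of "f j k" "tt j k"] by (simp add: bracket_diff_left)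
  next
    fix i j k l :: 3 assume "distinct [i, j, k, l]"
    then have False using exhaust3[of i] exhaust3[of j] exhaust3[of k] exhaust3[of l]
      by (elim disjE) simp_all
    then show "\<lblot>f i j, tt k l\<rblot> + \<lblot>tt i j, f k l\<rblot> = 0" ..
  qed (auto simp: f_def)
  then obtain D where D: "D \<in> der dk_scale" "\<And>i j. D (tt i j) = f i j" by blast
  have PD: "?P D" using D by (simp add: f_def)
  have "D' = D" if D': "?P D'" for D'
  proof
    fix x
    have "D' (tt i j) = D (tt i j)" for i j
      using exhaust3[of i] exhaust3[of j] D' PD derD(1)[of D' dk_scale] derD(1)[of D dk_scale]
      by (elim disjE) auto
    then show "D' x = D x"
      using dk_der_eqI[OF lie_hom_id D(1), of D' x] D' by simp
  qed
  then have "D_of C = D" unfolding D_of_def using PD by (intro the_equality) blast+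
  then show "D_of C \<in> der dk_scale" "D_of C (tt 1 2) = 0"
    "D_of C (tt 2 3) = \<lblot>?c, tt 2 3\<rblot>" "D_of C (tt 1 3) = \<lblot>?h, tt 1 3\<rblot>"
    using PD by simp_all
qed

section \<open>\<open>\<tt>\<^sub>4\<close> as an extension by a free Lie algebra\<close>

definition der_free ::
  "('g \<Rightarrow> ('k::comm_ring_1, 'g) free_lie) \<Rightarrow> ('k, 'g) free_lie \<Rightarrow> ('k, 'g) free_lie"
  where "der_free f x = coc_eval free_scale (\<lambda>g. lie_bracket (free_gen g)) f (rep_free_lie x)"

lemma lie_eval_free_gen: "lie_eval free_scale free_gen t = abs_free_lie t"
  by (induction t) (auto simp: free_gen.abs_eq zero_free_lie_def plus_free_lie.abs_eq
      free_scale.abs_eq lie_bracket_free_lie.abs_eq)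

lemma der_free_abs:
  "der_free f (abs_free_lie t) = coc_eval free_scale (\<lambda>g. lie_bracket (free_gen g)) f t"
proof -
  have "lie_cong {} (rep_free_lie (abs_free_lie t)) t"
    by (metis Quotient_free_lie Quotient_rep_abs lie_cong.refl)
  then show ?thesis
    unfolding der_free_def
    by (rule free_lie.coc_eval_cong[OF free_lie.module_hom_bracket, rotated -1]) simp_all
qed

lemma der_free_gen [simp]: "der_free f (free_gen g) = f g"
  by (simp add: free_gen.abs_eq der_free_abs)

lemma der_free: "der_free f \<in> der free_scale"
proof -
  have ex: "\<exists>t. x = abs_free_lie t" for x :: "('a, 'b) free_lie"
    by (metis Quotient_abs_rep Quotient_free_lie)
  have "der_free f (x + y) = der_free f x + der_free f y"
    "der_free f (free_scale c x) = free_scale c (der_free f x)"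
    "der_free f \<lblot>x, y\<rblot> = \<lblot>der_free f x, y\<rblot> + \<lblot>x, der_free f y\<rblot>" for x y c
    using ex[of x] ex[of y] bracket_anticommute[of "der_free f x" y]
    by (auto simp: plus_free_lie.abs_eq free_scale.abs_eq lie_bracket_free_lie.abs_eq der_free_abs
        free_lie.rep_eval_bracket lie_eval_free_gen)
  then show ?thesis by (simp add: der_def module_hom_iff free_lie.module_axioms)
qed

lemma (in lie_algebra) der_zero: "(\<lambda>x. 0) \<in> der scale"
  by (simp add: der_def module_hom_iff module_axioms)

lemma (in lie_algebra) der_bracket: "lie_bracket x \<in> der scale"
  unfolding der_def using module_hom_bracket[of x] bracket_bracket_right[of x] by blast

lemma (in lie_algebra) der_add: "A \<in> der scale \<Longrightarrow> B \<in> der scale \<Longrightarrow> (\<lambda>x. A x + B x) \<in> der scale"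
  by (simp add: der_def module_hom_iff module_axioms algebra_simps bracket_distribs)

text \<open>The commutator of two derivations is a derivation, so it vanishes once it vanishes on
  generators.\<close>

lemma der_free_commute:
  assumes "A \<in> der free_scale" "B \<in> der free_scale" "\<And>g. A (B (free_gen g)) = B (A (free_gen g))"
  shows "A (B x) = B (A x)"
  by (induction x rule: free_lie_induct)
    (simp_all add: derD[OF assms(1)] derD[OF assms(2)] assms(3) algebra_simps)

datatype strand = S1 | S2 | S3

instance strand :: finite
proof
  have "UNIV = {S1, S2, S3}" using strand.exhaust by blast
  then show "finite (UNIV :: strand set)" by (metis finite.simps)
qed

primrec strand_index :: "strand \<Rightarrow> 4"
  where "strand_index S1 = 1" | "strand_index S2 = 2" | "strand_index S3 = 3"

definition strand_gen :: "4 \<Rightarrow> ('k::comm_ring_1, strand) free_lie"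
  where "strand_gen i = (if i = 1 then free_gen S1 else if i = 2 then free_gen S2
    else if i = 3 then free_gen S3 else 0)"

text \<open>The action of \<open>\<tt>\<^sub>4\<close> on its ideal generated by \<open>t\<^sub>1\<^sub>4, t\<^sub>2\<^sub>4, t\<^sub>3\<^sub>4\<close>, lifted to the free Lie algebra on
  these generators.\<close>

definition act_gen :: "4 \<times> 4 \<Rightarrow> ('k::comm_ring_1, strand) free_lie \<Rightarrow> ('k, strand) free_lie"
  where "act_gen = (\<lambda>(i, j). if i = j then (\<lambda>v. 0) else if j = 4 then lie_bracket (strand_gen i)
    else if i = 4 then lie_bracket (strand_gen j)
    else der_free (\<lambda>p. if strand_index p = i then \<lblot>free_gen p, strand_gen j\<rblot>
      else if strand_index p = j then \<lblot>free_gen p, strand_gen i\<rblot> else 0))"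

lemma der_act_gen: "act_gen g \<in> der free_scale"
  by (cases g) (simp add: act_gen_def free_lie.der_zero free_lie.der_bracket der_free)

text \<open>Normalizing rewrite rules for the computations on generators; the last one is the Jacobi
  identity, eliminating one of three double brackets.\<close>

lemma strand_bracket:
  "\<lblot>free_gen S2, free_gen S1\<rblot> = - \<lblot>free_gen S1, free_gen S2\<rblot>"
  "\<lblot>free_gen S3, free_gen S1\<rblot> = - \<lblot>free_gen S1, free_gen S3\<rblot>"
  "\<lblot>free_gen S3, free_gen S2\<rblot> = - \<lblot>free_gen S2, free_gen S3\<rblot>"
  "\<lblot>\<lblot>free_gen a, free_gen b\<rblot>, free_gen c\<rblot> = - \<lblot>free_gen c, \<lblot>free_gen a, free_gen b\<rblot>\<rblot>"
  "\<lblot>free_gen S3, \<lblot>free_gen S1, free_gen S2\<rblot>\<rblot> =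
    \<lblot>free_gen S2, \<lblot>free_gen S1, free_gen S3\<rblot>\<rblot> - \<lblot>free_gen S1, \<lblot>free_gen S2, free_gen S3 :: ('k::comm_ring_1, strand) free_lie\<rblot>\<rblot>"
proof -
  show *: "\<lblot>free_gen S2, free_gen S1\<rblot> = - \<lblot>free_gen S1, free_gen S2\<rblot>"
    "\<lblot>free_gen S3, free_gen S1\<rblot> = - \<lblot>free_gen S1, free_gen S3\<rblot>"
    "\<lblot>free_gen S3, free_gen S2\<rblot> = - \<lblot>free_gen S2, free_gen S3\<rblot>"
    "\<lblot>\<lblot>free_gen a, free_gen b\<rblot>, free_gen c\<rblot> = - \<lblot>free_gen c, \<lblot>free_gen a, free_gen b\<rblot>\<rblot>" for a b c
    by (rule bracket_anticommute)+
  show "\<lblot>free_gen S3, \<lblot>free_gen S1, free_gen S2\<rblot>\<rblot> =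
    \<lblot>free_gen S2, \<lblot>free_gen S1, free_gen S3\<rblot>\<rblot> - \<lblot>free_gen S1, \<lblot>free_gen S2, free_gen S3 :: ('k::comm_ring_1, strand) free_lie\<rblot>\<rblot>"
    using bracket_bracket_right[of "free_gen S3" "free_gen S1" "free_gen S2 :: ('k::comm_ring_1, strand) free_lie"]
    by (simp add: *)
qed

text \<open>The three- and four-strand relations say that two derivations of the free Lie algebra
  commute, which is checked on its three generators.\<close>

lemma act_gen_rels:
  assumes "(u, v) \<in> dk_rels"
  shows "rep_eval free_scale act_gen u =
    (rep_eval free_scale act_gen v :: ('k::comm_ring_1, strand) free_lie \<Rightarrow> _)"
proof -
  let ?a = "act_gen :: 4 \<times> 4 \<Rightarrow> ('k, strand) free_lie \<Rightarrow> _"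
  have sym: "?a (j, i) = ?a (i, j)" for i j
    by (auto simp: act_gen_def intro!: arg_cong[of _ _ der_free])
  have rel3: "(\<lambda>x. ?a (i, j) x + ?a (i, k) x) (?a (j, k) v) = ?a (j, k) ((\<lambda>x. ?a (i, j) x + ?a (i, k) x) v)"
    if d: "distinct [i, j, k]" for i j k v
  proof (rule der_free_commute)
    fix g
    show "?a (i, j) (?a (j, k) (free_gen g)) + ?a (i, k) (?a (j, k) (free_gen g)) =
      ?a (j, k) (?a (i, j) (free_gen g) + ?a (i, k) (free_gen g))"
      using d exhaust4[of i] exhaust4[of j] exhaust4[of k]
      by (elim disjE; cases g; simp add: act_gen_def strand_gen_def derD[OF der_free] bracket_distribs
          bracket_self strand_bracket)
  qed (intro free_lie.der_add der_act_gen)+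
  have rel4: "?a (i, j) (?a (k, l) v) = ?a (k, l) (?a (i, j) v)" if d: "distinct [i, j, k, l]" for i j k l v
  proof (rule der_free_commute[OF der_act_gen der_act_gen])
    fix g
    show "?a (i, j) (?a (k, l) (free_gen g)) = ?a (k, l) (?a (i, j) (free_gen g))"
      using d exhaust4[of i] exhaust4[of j] exhaust4[of k] exhaust4[of l]
      by (elim disjE; cases g; simp add: act_gen_def strand_gen_def derD[OF der_free] bracket_distribs
          bracket_self strand_bracket)
  qed
  show ?thesis
    using assms
  proof (cases rule: dk_rels_cases)
    case (1 i)
    then show ?thesis by (simp add: act_gen_def)
  next
    case (2 i j)
    show ?thesis by (simp only: 2 rep_eval.simps sym)
  next
    case (3 i j k)
    then show ?thesis using rel3[OF 3(3)] by (simp add: fun_eq_iff)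
  next
    case (4 i j k l)
    then show ?thesis using rel4[OF 4(3)] by (simp add: fun_eq_iff)
  qed
qed

lift_definition act :: "('k::comm_ring_1, 4) dk \<Rightarrow> ('k, strand) free_lie \<Rightarrow> ('k, strand) free_lie"
  is "rep_eval free_scale act_gen"
  by (rule free_lie.rep_eval_cong) (use der_act_gen act_gen_rels in \<open>auto simp: der_def\<close>)

lemma act_simps [simp]:
  "act (tt i j) v = act_gen (i, j) v" "act 0 v = 0" "act (x + y) v = act x v + act y v"
  "act (dk_scale c x) v = free_scale c (act x v)"
  "act \<lblot>x, y\<rblot> v = act x (act y v) - act y (act x v)"
  subgoal by transfer simp
  subgoal by transfer simp
  subgoal by transfer simp
  subgoal by transfer simp
  subgoal by transfer simp
  done

definition free_t4 :: "('k::comm_ring_1, strand) free_lie \<Rightarrow> ('k, 4) dk"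
  where "free_t4 = free_subst dk_scale (\<lambda>p. tt (strand_index p) 4)"

lemma lie_hom_free_t4: "lie_hom free_scale dk_scale free_t4"
  unfolding free_t4_def by (rule dk.lie_hom_free_subst)

lemmas free_t4_simps [simp] = lie_homD[OF lie_hom_free_t4]

lemma free_t4_gen [simp]: "free_t4 (free_gen p) = tt (strand_index p) 4"
  by (simp add: free_t4_def)

text \<open>Both sides are compatible with brackets in \<open>z\<close> and obey the Leibniz rule in
  \<open>y\<close>, so generators suffice. In particular the image of \<open>free_t4\<close> is an
  ideal.\<close>

lemma bracket_free_t4: "\<lblot>z, free_t4 y\<rblot> = free_t4 (act z y)"
proof (induction z arbitrary: y rule: dk_induct)
  case (gen i j)
  show ?case
  proof (induction y rule: free_lie_induct)
    case (gen p)
    show ?case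
      using exhaust4[of i] exhaust4[of j]
      by (elim disjE; cases p; simp add: act_gen_def strand_gen_def derD[OF der_free] tt4_bracket bracket_self)
  next
    case (br u v)
    have "\<lblot>tt i j, free_t4 \<lblot>u, v\<rblot>\<rblot> = \<lblot>\<lblot>tt i j, free_t4 u\<rblot>, free_t4 v\<rblot> + \<lblot>free_t4 u, \<lblot>tt i j, free_t4 v\<rblot>\<rblot>"
      by (simp only: free_t4_simps) (rule bracket_bracket_right)
    then show ?case by (simp only: br act_simps derD[OF der_act_gen] free_t4_simps)
  qed (simp_all add: derD[OF der_act_gen] bracket_add_right dk.bracket_scale_right)
qed (simp_all add: bracket_add_left dk.bracket_scale_left bracket_bracket_left)

lemma act_free_t4: "act (free_t4 u) v = \<lblot>u, v\<rblot>"
proof (induction u arbitrary: v rule: free_lie_induct)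
  case (gen p)
  show ?case by (cases p) (simp_all add: act_gen_def strand_gen_def)
qed (simp_all add: bracket_add_left free_lie.bracket_scale_left bracket_bracket_left)

text \<open>A central element is a multiple of two different generators; sending all generators but
  one to zero separates them.\<close>

lemma central_free_lie:
  fixes y :: "('k::comm_rat_algebra, strand) free_lie"
  assumes "\<And>v. \<lblot>y, v\<rblot> = 0"
  shows "y = 0"
proof -
  have "\<lblot>free_gen p, y\<rblot> = 0" for p by (rule bracket_eq_0_commute) (rule assms)
  then obtain a b where a: "y = free_scale a (free_gen S1)" and b: "y = free_scale b (free_gen S2)"
    using centralizer_free_gen by blast
  let ?s = "free_subst free_scale (\<lambda>p. if p = S1 then free_gen S1 else 0 :: ('k, strand) free_lie)"
  have "?s y = y" unfolding a by (simp add: lie_homD[OF free_lie.lie_hom_free_subst])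
  moreover have "?s y = 0" unfolding b by (simp add: lie_homD[OF free_lie.lie_hom_free_subst])
  ultimately show ?thesis by simp
qed

text \<open>If the image of \<open>y\<close> vanishes, so does its action, which is the adjoint
  action of \<open>y\<close> on the free Lie algebra. Hence \<open>y\<close> is central there and so
  zero; no semidirect product has to be constructed.\<close>

lemma free_t4_eq_0:
  fixes y :: "('k::comm_rat_algebra, strand) free_lie"
  assumes "free_t4 y = 0"
  shows "y = 0"
  by (rule central_free_lie) (simp add: act_free_t4[symmetric] assms)

definition pull12_34 :: "('k::comm_ring_1, 3) dk \<Rightarrow> ('k, 4) dk"
  where "pull12_34 = dk_pull [1 \<mapsto> 1, 2 \<mapsto> 2, 3 \<mapsto> 3, 4 \<mapsto> 3]"

lemma lie_hom_pull12_34: "lie_hom dk_scale dk_scale pull12_34"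
  unfolding pull12_34_def by (rule lie_hom_dk_pull)

lemmas pull12_34_simps [simp] = lie_homD[OF lie_hom_pull12_34]

lemma pull12_34_subst_dk [simp]:
  "pull12_34 (subst_dk C a b) = subst_dk C (pull12_34 a) (pull12_34 b)"
  by (simp add: pull12_34_def)

lemma pull12_34_tt [simp]:
  "pull12_34 (tt 1 2) = tt 1 2" "pull12_34 (tt 1 3) = tt 1 3 + tt 1 4"
  "pull12_34 (tt 2 3) = tt 2 3 + tt 2 4"
  by (simp_all add: pull12_34_def dk_pull_t sum_Collect4)

text \<open>The image of \<open>pull12_34\<close> is a subalgebra and that of \<open>free_t4\<close>
  an ideal, so their sum is closed under brackets; it contains all generators.\<close>

lemma t4_decomp:
  obtains y q where "x = free_t4 y + pull12_34 q"
proof -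
  let ?I = "\<lambda>x. \<exists>y q. x = free_t4 y + pull12_34 q"
  have gens: "?I (tt 1 4)" "?I (tt 2 4)" "?I (tt 3 4)" "?I (tt 1 2)" "?I (tt 1 3)" "?I (tt 2 3)"
    by (rule exI[of _ "free_gen S1"], rule exI[of _ 0], simp)
      (rule exI[of _ "free_gen S2"], rule exI[of _ 0], simp,
       rule exI[of _ "free_gen S3"], rule exI[of _ 0], simp,
       rule exI[of _ 0], rule exI[of _ "tt 1 2"], simp,
       rule exI[of _ "- free_gen S1"], rule exI[of _ "tt 1 3"], simp,
       rule exI[of _ "- free_gen S2"], rule exI[of _ "tt 2 3"], simp)
  have "?I x"
  proof (induction x rule: dk_induct)
    case (gen i j)
    have "?I 0" by (intro exI[of _ 0]) simp
    then show ?case using gens exhaust4[of i] exhaust4[of j]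
      by (elim disjE) (simp_all only: t_self tt4_sort)
  next
    case zero
    show ?case by (intro exI[of _ 0]) simp
  next
    case (add x y)
    then obtain u q v r where "x = free_t4 u + pull12_34 q" "y = free_t4 v + pull12_34 r" by blast
    then show ?case by (intro exI[of _ "u + v"] exI[of _ "q + r"]) simp
  next
    case (scale c x)
    then obtain u q where "x = free_t4 u + pull12_34 q" by blast
    then show ?case
      by (intro exI[of _ "free_scale c u"] exI[of _ "dk_scale c q"]) (simp add: dk.scale_right_distrib)
  next
    case (br x y)
    then obtain u q v r where x: "x = free_t4 u + pull12_34 q" and y: "y = free_t4 v + pull12_34 r" by blast
    have "\<lblot>free_t4 u, pull12_34 r\<rblot> = free_t4 (- act (pull12_34 r) u)"
      by (subst bracket_anticommute) (simp add: bracket_free_t4)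
    then show ?case unfolding x y
      by (intro exI[of _ "\<lblot>u, v\<rblot> + act (pull12_34 q) v - act (pull12_34 r) u"] exI[of _ "\<lblot>q, r\<rblot>"])
        (simp add: bracket_distribs bracket_free_t4)
  qed
  then show ?thesis using that by blast
qed

lemma pull12_34_c3: "pull12_34 c3 = c4 - tt 3 4"
  by (simp add: c3_def c4_def algebra_simps)

text \<open>Both t_12 and t_13 + t_14 commute with t_34, so bracketing with t_34 sees only the
  component in the free ideal. Centralizer questions in t_4 thereby become questions in a free Lie
  algebra.\<close>

lemma t4_decomp':
  obtains y P m where
    "x = free_t4 y + subst_dk P (tt 1 2) (tt 1 3 + tt 1 4) + dk_scale m (c4 - tt 3 4)"
    "\<lblot>tt 3 4, x\<rblot> = free_t4 \<lblot>free_gen S3, y\<rblot>"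
proof -
  obtain y q where x: "x = free_t4 y + pull12_34 q" by (rule t4_decomp)
  obtain P m where q: "q = subst_dk P (tt 1 2) (tt 1 3) + dk_scale m c3"
    by (rule t3_decomp[of 1 2 3]) simp_all
  have "\<lblot>tt 3 4, subst_dk P (tt 1 2) (tt 1 3 + tt 1 4) :: ('a, 4) dk\<rblot> = 0"
    by (rule dk.bracket_subst2_0) (simp_all add: tt4_bracket bracket_add_right)
  then have "\<lblot>tt 3 4, x\<rblot> = free_t4 \<lblot>free_gen S3, y\<rblot>"
    by (simp add: x q pull12_34_c3 bracket_add_right bracket_diff_right dk.bracket_scale_right bracket_self)
  then show ?thesis using that[of y P m] x q by (simp add: pull12_34_c3 add.assoc)
qed

lemma centralizer_t34:
  fixes x :: "('k::comm_rat_algebra, 4) dk"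
  assumes "\<lblot>tt 3 4, x\<rblot> = 0"
  obtains l P m where
    "x = dk_scale l (tt 3 4) + subst_dk P (tt 1 2) (tt 1 3 + tt 1 4) + dk_scale m c4"
proof -
  obtain y P m where x: "x = free_t4 y + subst_dk P (tt 1 2) (tt 1 3 + tt 1 4) + dk_scale m (c4 - tt 3 4)"
    "\<lblot>tt 3 4, x\<rblot> = free_t4 \<lblot>free_gen S3, y\<rblot>"
    by (rule t4_decomp')
  then have "\<lblot>free_gen S3, y\<rblot> = 0" using assms free_t4_eq_0 by metis
  then obtain a where "y = free_scale a (free_gen S3)" using centralizer_free_gen by blast
  then have "x = dk_scale (a - m) (tt 3 4) + subst_dk P (tt 1 2) (tt 1 3 + tt 1 4) + dk_scale m c4"
    using x(1) by (simp add: dk.scale_left_diff_distrib dk.scale_right_diff_distrib algebra_simps)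
  then show ?thesis by (rule that)
qed

section \<open>Relabelling of strands and further centralizers in t_4\<close>

lemma dk_pull_inverse:
  assumes "\<And>i j :: 4. dk_pull \<phi> (dk_pull \<psi> (tt i j)) = (tt i j :: ('k::comm_ring_1, 4) dk)"
  shows "dk_pull \<phi> (dk_pull \<psi> x) = (x :: ('k, 4) dk)"
  using dk_hom_eqI[of dk_scale "\<lambda>x :: ('k, 4) dk. dk_pull \<phi> (dk_pull \<psi> x)" "\<lambda>x. x"] assms
  by (simp add: lie_hom_def module_hom_iff dk.module_axioms)

lemma tt4_eqI:
  assumes "f (tt 1 2) = g (tt 1 2)" "f (tt 1 3) = g (tt 1 3)" "f (tt 1 4) = g (tt 1 4)"
    "f (tt 2 3) = g (tt 2 3)" "f (tt 2 4) = g (tt 2 4)" "f (tt 3 4) = g (tt 3 4)" "f 0 = g 0"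
  shows "f (tt i j) = g (tt i (j :: 4))"
  using assms exhaust4[of i] exhaust4[of j] by (elim disjE) (simp_all only: t_self tt4_sort)

definition perm :: "4 \<Rightarrow> 4 \<Rightarrow> 4 \<Rightarrow> 4 \<Rightarrow> ('k::comm_ring_1, 4) dk \<Rightarrow> ('k, 4) dk"
  where "perm a b c d = dk_pull [a \<mapsto> 1, b \<mapsto> 2, c \<mapsto> 3, d \<mapsto> 4]"

lemma lie_hom_perm: "lie_hom dk_scale dk_scale (perm a b c d)"
  unfolding perm_def by (rule lie_hom_dk_pull)

lemmas perm_simps [simp] = lie_homD[OF lie_hom_perm]

lemma perm_subst_dk [simp]:
  "perm a b c d (subst_dk C x y) = subst_dk C (perm a b c d x) (perm a b c d y)"
  by (simp add: perm_def)

lemma perm_tt [simp]: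
  assumes "distinct [a, b, c, d]"
  shows "perm a b c d (tt 1 2) = tt a b" "perm a b c d (tt 1 3) = tt a c"
    "perm a b c d (tt 1 4) = tt a d" "perm a b c d (tt 2 3) = tt b c"
    "perm a b c d (tt 2 4) = tt b d" "perm a b c d (tt 3 4) = tt c d"
proof -
  let ?\<phi> = "[a \<mapsto> 1, b \<mapsto> 2, c \<mapsto> 3, d \<mapsto> 4] :: 4 \<rightharpoonup> 4"
  have [simp]: "{x. ?\<phi> x = Some 1} = {a}" "{x. ?\<phi> x = Some 2} = {b}"
    "{x. ?\<phi> x = Some 3} = {c}" "{x. ?\<phi> x = Some 4} = {d}"
    using assms by (auto split: if_splits)
  show "perm a b c d (tt 1 2) = tt a b" "perm a b c d (tt 1 3) = tt a c"
    "perm a b c d (tt 1 4) = tt a d" "perm a b c d (tt 2 3) = tt b c"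
    "perm a b c d (tt 2 4) = tt b d" "perm a b c d (tt 3 4) = tt c d"
    by (simp_all add: perm_def dk_pull_t del: fun_upd_apply)
qed

lemma perm_c4 [simp]: "perm 3 4 1 2 c4 = c4" "perm 1 3 4 2 c4 = c4" "perm 2 3 4 1 c4 = c4"
  by (simp_all add: c4_def algebra_simps)

lemma perm_perm:
  assumes "\<And>i j. perm a b c d (perm a' b' c' d' (tt i j)) = (tt i j :: ('k::comm_ring_1, 4) dk)"
  shows "perm a b c d (perm a' b' c' d' x) = (x :: ('k, 4) dk)"
  using assms unfolding perm_def by (rule dk_pull_inverse)

text \<open>The relabelling that exchanges strands 1, 2 with strands 3, 4 reduces this to
  \<open>centralizer_t34\<close>.\<close>

lemma centralizer_t12:
  fixes x :: "('k::comm_rat_algebra, 4) dk"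
  assumes "\<lblot>tt 1 2, x\<rblot> = 0"
  obtains l P m where
    "x = dk_scale l (tt 1 2) + subst_dk P (tt 3 4) (tt 1 3 + tt 2 3) + dk_scale m c4"
proof -
  have inv: "perm 3 4 1 2 (perm 3 4 1 2 z) = z" for z :: "('k, 4) dk"
    by (rule perm_perm, rule tt4_eqI) simp_all
  have "\<lblot>tt 3 4, perm 3 4 1 2 x\<rblot> = perm 3 4 1 2 \<lblot>tt 1 2, x\<rblot>" by simp
  then have "\<lblot>tt 3 4, perm 3 4 1 2 x\<rblot> = 0" using assms by simp
  then obtain l P m where
    "perm 3 4 1 2 x = dk_scale l (tt 3 4) + subst_dk P (tt 1 2) (tt 1 3 + tt 1 4) + dk_scale m c4"
    by (rule centralizer_t34)
  then have "perm 3 4 1 2 (perm 3 4 1 2 x) =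
      perm 3 4 1 2 (dk_scale l (tt 3 4) + subst_dk P (tt 1 2) (tt 1 3 + tt 1 4) + dk_scale m c4)"
    by (simp only:)
  then show ?thesis using that[of l P m] by (simp add: inv)
qed

lemma free_t4_subst2 [simp]: "free_t4 (subst2 free_scale C a b) = subst_dk C (free_t4 a) (free_t4 b)"
  by (rule subst2_hom[OF lie_hom_free_t4 free_lie.lie_algebra_axioms dk.lie_algebra_axioms])

text \<open>Up to multiples of \<open>t\<^sub>1\<^sub>2\<close> and \<open>c4\<close>, this is \<open>centralizer_t12\<close>. Removing strand 4 shows that the first
  multiple vanishes, and the injectivity of \<open>free_t4\<close> that the second one does.\<close>

lemma free_t4_centralizer_t12:
  fixes v :: "('k::comm_rat_algebra, strand) free_lie"
  assumes "\<lblot>tt 1 2, free_t4 v\<rblot> = 0"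
  obtains P where "v = subst2 free_scale P (free_gen S3) (free_gen S1 + free_gen S2)"
proof -
  obtain l P m where v: "free_t4 v = dk_scale l (tt 1 2) + subst_dk P (tt 3 4) (tt 1 3 + tt 2 3) + dk_scale m c4"
    using assms by (rule centralizer_t12)
  \<comment> \<open>To land in the image of \<open>free_t4\<close>, t_13 + t_23 is replaced by -
    t_34 - (t_14 + t_24), the value of \<open>einf\<close>. The difference c4 - t_12 commutes with
    both new arguments.\<close>
  define Q where "Q = subst_lie2 P e0 einf"
  have "subst_dk P (tt 3 4) (tt 1 3 + tt 2 3) =
      subst_dk P (tt 3 4 + 0) ((- tt 3 4 - (tt 1 4 + tt 2 4)) + (c4 - tt 1 2))"
    by (simp add: c4_def algebra_simps)
  also have "\<dots> = subst_dk P (tt 3 4) (- tt 3 4 - (tt 1 4 + tt 2 4)) +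
      subst_dk (lin P) 0 (c4 - tt 1 2 :: ('k, 4) dk)"
    by (rule dk.subst2_shift) (simp_all add: bracket_distribs tt4_bracket)
  also have "subst_dk P (tt 3 4) (- tt 3 4 - (tt 1 4 + tt 2 4)) =
      (free_t4 (subst2 free_scale Q (free_gen S3) (free_gen S1 + free_gen S2)) :: ('k, 4) dk)"
    by (simp add: Q_def subst_dk_subst_lie2)
  finally have P: "subst_dk P (tt 3 4) (tt 1 3 + tt 2 3) =
      free_t4 (subst2 free_scale Q (free_gen S3) (free_gen S1 + free_gen S2)) +
      subst_dk (lin P) 0 (c4 - tt 1 2 :: ('k, 4) dk)" .
  obtain a b where ab: "lin P = free_scale a e0 + free_scale b e1" using lin_lie2 by blast
  define w where "w = v - subst2 free_scale Q (free_gen S3) (free_gen S1 + free_gen S2)"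
  have w: "free_t4 w = dk_scale (l - b) (tt 1 2) + dk_scale (m + b) c4"
    using v by (simp add: w_def P ab algebra_simps)
  have "kill 1 2 3 (free_t4 y) = 0" for y :: "('k, strand) free_lie"
  proof (induction y rule: free_lie_induct)
    case (gen p)
    show ?case by (cases p) simp_all
  qed simp_all
  then have "kill 1 2 3 (dk_scale (l - b) (tt 1 2) + dk_scale (m + b) c4 :: ('k, 4) dk) = 0"
    using w by metis
  then have "free_scale (l - b) e1 = (0 :: 'k lie2)"
    by (simp add: c4_def einf_def)
  then have "subst_dk (free_scale (l - b) e1) 0 (tt 1 2) = (0 :: ('k, 4) dk)" by simp
  then have w': "free_t4 w = dk_scale (m + b) c4" using w by simp
  \<comment> \<open>The image of \<open>w\<close> is central in t_4, so \<open>w\<close> acts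
    trivially on the free Lie algebra, which means that it is central there.\<close>
  have "w = 0"
  proof (rule central_free_lie)
    fix u
    have "free_t4 (act (c4 :: ('k, 4) dk) u) = 0" by (simp add: bracket_free_t4[symmetric])
    then have "act (c4 :: ('k, 4) dk) u = 0" by (rule free_t4_eq_0)
    then show "\<lblot>w, u\<rblot> = 0" by (simp add: act_free_t4[symmetric] w')
  qed
  then show ?thesis using that[of Q] by (simp add: w_def)
qed

text \<open>The bracket of t_34 with \<open>W\<close> lies in the free ideal and commutes with t_12,
  so by \<open>free_t4_centralizer_t12\<close> it involves only t_34 and t_14 + t_24. A retraction
  onto the subalgebra generated by these two splits the free component of \<open>W\<close> into a
  part in this subalgebra and an element centralizing t_34.\<close>

lemma double_bracket_t12_t34:
  fixes W :: "('k::comm_rat_algebra, 4) dk"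
  assumes "\<lblot>tt 1 2, \<lblot>tt 3 4, W\<rblot>\<rblot> = 0"
  obtains Q R m where
    "W = subst_dk Q (tt 3 4) (tt 1 4 + tt 2 4) + subst_dk R (tt 1 2) (tt 1 3 + tt 1 4) + dk_scale m c4"
proof -
  obtain y R m where W: "W = free_t4 y + subst_dk R (tt 1 2) (tt 1 3 + tt 1 4) + dk_scale m (c4 - tt 3 4)"
    "\<lblot>tt 3 4, W\<rblot> = free_t4 \<lblot>free_gen S3, y\<rblot>"
    by (rule t4_decomp')
  then have "\<lblot>tt 1 2, free_t4 \<lblot>free_gen S3, y\<rblot>\<rblot> = 0" using assms by simp
  then obtain P where P: "\<lblot>free_gen S3, y\<rblot> = subst2 free_scale P (free_gen S3) (free_gen S1 + free_gen S2)"
    by (rule free_t4_centralizer_t12)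
  \<comment> \<open>The retraction: it fixes S3, and it fixes S1 + S2 because S1 goes to zero and S2
    to the sum.\<close>
  let ?x = "\<lambda>p. case p of S1 \<Rightarrow> 0 | S2 \<Rightarrow> free_gen S1 + free_gen S2 | S3 \<Rightarrow> (free_gen S3 :: ('k, strand) free_lie)"
  let ?r = "free_subst free_scale ?x"
  note r = lie_homD[OF free_lie.lie_hom_free_subst, of ?x]
  have "?r (subst2 free_scale P (free_gen S3) (free_gen S1 + free_gen S2)) =
     subst2 free_scale P (free_gen S3) (free_gen S1 + free_gen S2)"
    by (subst subst2_hom[OF free_lie.lie_hom_free_subst free_lie.lie_algebra_axioms free_lie.lie_algebra_axioms])
      (simp add: r)
  then have "\<lblot>free_gen S3, ?r y\<rblot> = \<lblot>free_gen S3, y\<rblot>"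
    using r(6)[of "free_gen S3" y] P by simp
  then have "\<lblot>free_gen S3, y - ?r y\<rblot> = 0" by (simp add: bracket_diff_right)
  then obtain a where a: "y - ?r y = free_scale a (free_gen S3)" using centralizer_free_gen by blast
  have "\<exists>Q. ?r z = subst2 free_scale Q (free_gen S3) (free_gen S1 + free_gen S2)" for z
  proof (induction z rule: free_lie_induct)
    case (gen p)
    show ?case
    proof (cases p)
      case S1
      show ?thesis by (rule exI[of _ 0]) (simp add: S1)
    next
      case S2
      show ?thesis by (rule exI[of _ e1]) (simp add: S2)
    next
      case S3
      show ?thesis by (rule exI[of _ e0]) (simp add: S3)
    qed
  next
    case zero
    show ?case by (rule exI[of _ 0]) (simp add: r)
  next
    case (add x y)
    then show ?case by (metis r(2) free_lie.subst2_simps(4))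
  next
    case (scale c x)
    then show ?case by (metis r(5) free_lie.subst2_simps(7))
  next
    case (br x y)
    then show ?case by (metis r(6) free_lie.subst2_simps(8))
  qed
  then obtain Q where Q: "?r y = subst2 free_scale Q (free_gen S3) (free_gen S1 + free_gen S2)" by blast
  have "y = subst2 free_scale Q (free_gen S3) (free_gen S1 + free_gen S2) + free_scale a (free_gen S3)"
    using a Q by (simp add: algebra_simps)
  then have "W = subst_dk (Q + free_scale (a - m) e0) (tt 3 4) (tt 1 4 + tt 2 4) +
      subst_dk R (tt 1 2) (tt 1 3 + tt 1 4) + dk_scale m c4"
    using W(1) by (simp add: dk.scale_left_diff_distrib dk.scale_right_diff_distrib algebra_simps)
  then show ?thesis by (rule that)
qed

section \<open>The pentagon equation\<close>

lemma lie_hom_mu123: "lie_hom dk_scale dk_scale mu123"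
  unfolding mu123_def by (rule lie_hom_dk_pull)

lemma lie_hom_mu124: "lie_hom dk_scale dk_scale mu124"
  unfolding mu124_def by (rule lie_hom_dk_pull)

lemma mu_tt [simp]:
  "mu123 (tt 1 2) = tt 1 2" "mu123 (tt 1 3) = tt 1 3" "mu123 (tt 2 3) = tt 2 3"
  "mu124 (tt 1 2) = tt 1 2" "mu124 (tt 1 3) = tt 1 4" "mu124 (tt 2 3) = tt 2 4"
  by (simp_all add: mu123_def mu124_def dk_pull_t sum_Collect4)

lemma mu_subst_dk [simp]:
  "mu123 (subst_dk C a b) = subst_dk C (mu123 a) (mu123 b)"
  "mu124 (subst_dk C a b) = subst_dk C (mu124 a) (mu124 b)"
  by (simp_all add: mu123_def mu124_def)

lemma pent_emb:
  "pent (emb C) = subst_dk C (tt 3 4) (tt 2 3) + subst_dk C (tt 2 4 + tt 3 4) (tt 1 2 + tt 1 3)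
    + subst_dk C (tt 2 3) (tt 1 2) - subst_dk C (tt 3 4) (tt 1 3 + tt 2 3)
    - subst_dk C (tt 2 3 + tt 2 4) (tt 1 2)"
  by (simp add: pent_def emb_def dk_pull_t sum_Collect4)

text \<open>The argument \<open>- x - y\<close> is \<open>z\<close> minus the sum of all three
  elements, and that sum commutes with each of them.\<close>

lemma (in lie_algebra) subst2_einf_shift:
  assumes "lin C = 0" "\<lblot>x + y + z, x\<rblot> = 0" "\<lblot>x + y + z, y\<rblot> = 0"
  shows "subst2 scale C y (- x - y) = subst2 scale C y z"
proof -
  let ?s = "x + y + z"
  have "\<lblot>?s, ?s - x - y\<rblot> = 0" using assms by (simp only: bracket_diff_right bracket_self) simp
  then have z: "\<lblot>?s, z\<rblot> = 0" by (simp add: algebra_simps)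
  have "subst2 scale C (y + 0) (z + (- ?s)) = subst2 scale C y z + subst2 scale (lin C) 0 (- ?s)"
    by (rule subst2_shift) (use assms z in \<open>simp_all only: bracket_uminus_left, simp_all\<close>)
  then show ?thesis using assms by (simp add: algebra_simps)
qed

lemma subst_dk_antisym:
  assumes "subst_lie2 C e0 e1 + subst_lie2 C e1 e0 = 0"
  shows "subst_dk C a b = - subst_dk C b a"
proof -
  have "subst_dk (subst_lie2 C e0 e1 + subst_lie2 C e1 e0) a b = 0" using assms by simp
  then show ?thesis by (simp add: subst_dk_subst_lie2 eq_neg_iff_add_eq_0)
qed

text \<open>These are the forms in which the pentagon arises from [t_13, t_24] = 0 and [t_23, t_14]
  = 0: each parenthesis compares the two copies of t_3, with C(t_13 + t_23, t_14 + t_24) in the role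
  of X.\<close>

lemma perm_pent:
  fixes C :: "'k::comm_ring_1 lie2"
  assumes "lin C = 0" and anti: "subst_lie2 C e0 e1 + subst_lie2 C e1 e0 = 0"
    and h: "h = - subst_lie2 C e1 einf"
  shows "perm 3 1 2 4 (pent (emb C)) = subst_dk C (tt 1 3) (tt 1 2 + tt 1 4)
      - subst_dk C (tt 2 4) (tt 1 2 + tt 2 3)
      - (subst_dk h (tt 2 3) (tt 1 2) - subst_dk C (tt 2 4) (tt 1 2)
        + subst_dk C (tt 1 3 + tt 2 3) (tt 1 4 + tt 2 4))"
    and "perm 3 2 1 4 (pent (emb C)) = subst_dk C (tt 2 3) (tt 1 2 + tt 2 4)
      - subst_dk C (tt 1 4) (tt 1 2 + tt 1 3)
      - (subst_dk C (tt 2 3) (tt 1 2) - subst_dk h (tt 2 4) (tt 1 2)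
        + subst_dk C (tt 1 3 + tt 2 3) (tt 1 4 + tt 2 4))"
proof -
  have a: "subst_dk C x y = - subst_dk C y x" for x y :: "('k, 4) dk"
    by (rule subst_dk_antisym[OF anti])
  have "subst_dk h (tt 2 3) (tt 1 2) = - subst_dk C (tt 1 2) (- tt 2 3 - tt 1 2)"
    by (simp add: h subst_dk_subst_lie2)
  also have "subst_dk C (tt 1 2) (- tt 2 3 - tt 1 2) = subst_dk C (tt 1 2) (tt 1 (3::4))"
    by (rule dk.subst2_einf_shift) (use assms in \<open>simp_all add: bracket_add_left tt4_bracket bracket_self\<close>)
  finally have h1: "subst_dk h (tt 2 3) (tt 1 2) = - subst_dk C (tt 1 2) (tt 1 (3::4))" .
  have "subst_dk h (tt 2 4) (tt 1 2) = - subst_dk C (tt 1 2) (- tt 2 4 - tt 1 2)"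
    by (simp add: h subst_dk_subst_lie2)
  also have "subst_dk C (tt 1 2) (- tt 2 4 - tt 1 2) = subst_dk C (tt 1 2) (tt 1 (4::4))"
    by (rule dk.subst2_einf_shift) (use assms in \<open>simp_all add: bracket_add_left tt4_bracket bracket_self\<close>)
  finally have h2: "subst_dk h (tt 2 4) (tt 1 2) = - subst_dk C (tt 1 2) (tt 1 (4::4))" .
  show "perm 3 1 2 4 (pent (emb C)) = subst_dk C (tt 1 3) (tt 1 2 + tt 1 4)
      - subst_dk C (tt 2 4) (tt 1 2 + tt 2 3)
      - (subst_dk h (tt 2 3) (tt 1 2) - subst_dk C (tt 2 4) (tt 1 2)
        + subst_dk C (tt 1 3 + tt 2 3) (tt 1 4 + tt 2 4))"
    using a[of "tt 1 3" "tt 1 2 + tt 1 4"] a[of "tt 1 3 + tt 2 3" "tt 1 4 + tt 2 4"]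
    by (simp add: pent_emb h1 add.commute[of "tt 1 4" "tt 1 2"] add.commute[of "tt 2 3" "tt 1 2"])
  show "perm 3 2 1 4 (pent (emb C)) = subst_dk C (tt 2 3) (tt 1 2 + tt 2 4)
      - subst_dk C (tt 1 4) (tt 1 2 + tt 1 3)
      - (subst_dk C (tt 2 3) (tt 1 2) - subst_dk h (tt 2 4) (tt 1 2)
        + subst_dk C (tt 1 3 + tt 2 3) (tt 1 4 + tt 2 4))"
    using a[of "tt 2 3" "tt 1 2 + tt 2 4"] a[of "tt 1 3 + tt 2 3" "tt 1 4 + tt 2 4"]
      a[of "tt 1 2" "tt 1 4"] a[of "tt 1 2" "tt 2 3"]
    by (simp add: pent_emb h2 add.commute[of "tt 2 3" "tt 1 3"] add.commute[of "tt 1 3" "tt 1 2"]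
      add.commute[of "tt 2 4" "tt 1 4"] add.commute[of "tt 2 4" "tt 1 2"])
qed

text \<open>The left-hand side is what the Leibniz rule makes of the relation [a, b] = 0 if a
  derivation takes the values [A, a] and [A', b]. Because a and b commute, only the difference of A
  and A' matters.\<close>

lemma bracket_commuting_pair:
  assumes "\<lblot>a, b :: 'a::lie_ring\<rblot> = 0"
  shows "\<lblot>\<lblot>A, a\<rblot>, b\<rblot> + \<lblot>a, \<lblot>A', b\<rblot>\<rblot> = \<lblot>a, \<lblot>b, A - A'\<rblot>\<rblot>"
proof -
  have 1: "\<lblot>\<lblot>A, a\<rblot>, b\<rblot> = - \<lblot>a, \<lblot>A, b\<rblot>\<rblot>"
    using bracket_bracket_right[of A a b] assms by (simp add: eq_neg_iff_add_eq_0)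
  have 2: "\<lblot>b, A - A'\<rblot> = - \<lblot>A, b\<rblot> + \<lblot>A', b\<rblot>"
    by (subst bracket_anticommute) (simp add: bracket_diff_left)
  show ?thesis by (simp only: 1 2 bracket_add_right bracket_uminus_right)
qed

section \<open>From \<open>\<gg>\<rr>\<tt>\<^sub>1\<close> to derivations of \<open>\<tt>\<^sub>4\<close>\<close>

text \<open>\<open>B i j k l\<close> is the Leibniz image of [t_ij, t_kl]. As the values add up to
  zero and \<open>c4\<close> is central, the sum of \<open>B\<close> over all pairs in its first
  slot vanishes; this yields the relations that involve strands 3 and 4 together.\<close>

lemma ex_der_t4:
  fixes f :: "4 \<Rightarrow> 4 \<Rightarrow> ('k::comm_ring_1, 4) dk"
  defines "B \<equiv> \<lambda>i j k l. \<lblot>f i j, tt k l\<rblot> + \<lblot>tt i j, f k l\<rblot>"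
  assumes self: "\<And>i. f i i = 0" and sym: "\<And>i j. f j i = f i j"
    and total: "f 1 2 + f 1 3 + f 2 3 + f 1 4 + f 2 4 + f 3 4 = 0"
    and t123: "B 1 2 2 3 + B 1 3 2 3 = 0" "B 1 2 1 3 + B 2 3 1 3 = 0" "B 1 3 1 2 + B 2 3 1 2 = 0"
    and t124: "B 1 2 2 4 + B 1 4 2 4 = 0" "B 1 2 1 4 + B 2 4 1 4 = 0" "B 1 4 1 2 + B 2 4 1 2 = 0"
    and pairs: "B 1 2 3 4 = 0" "B 1 3 2 4 = 0" "B 2 3 1 4 = 0"
  shows "\<exists>D\<in>der dk_scale. \<forall>i j. D (tt i j) = f i j"
proof (rule ex_der_dk[OF self sym])
  have anti: "B k l i j = - B i j k l" for i j k l
    using bracket_anticommute[of "f i j" "tt k l"] bracket_anticommute[of "tt i j" "f k l"]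
    by (simp add: B_def)
  have sym1: "B j i k l = B i j k l" and sym2: "B i j l k = B i j k l" for i j k l
    by (simp_all add: B_def sym t_commute[of j i] t_commute[of l k])
  have all: "B 1 2 k l + B 1 3 k l + B 2 3 k l + B 1 4 k l + B 2 4 k l + B 3 4 k l = 0" for k l
  proof -
    have "B 1 2 k l + B 1 3 k l + B 2 3 k l + B 1 4 k l + B 2 4 k l + B 3 4 k l =
      \<lblot>f 1 2 + f 1 3 + f 2 3 + f 1 4 + f 2 4 + f 3 4, tt k l\<rblot> + \<lblot>c4, f k l\<rblot>"
      unfolding B_def c4_def by (simp only: bracket_add_left) (simp only: ac_simps)
    then show ?thesis by (simp add: total)
  qed
  have diag: "B i j i j = 0" for i j
    using bracket_anticommute[of "f i j" "tt i j"] by (simp add: B_def)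
  have pairs': "B 3 4 1 2 = 0" "B 2 4 1 3 = 0" "B 1 4 2 3 = 0"
    using pairs anti by (metis minus_zero)+
  have cancel: "x + y = 0" if "u + w = 0" "a + b + c + d + e + g = 0" "z = 0" "z' = 0"
    "a + b + c + d + e + g = (u + w) + z + z' + (x + y)" for a b c d e g u w z z' x y :: "('k, 4) dk"
    using that by simp
  \<comment> \<open>Of the six terms of \<open>all\<close>, two cancel by a known three-strand
    relation, one is diagonal and one belongs to a commuting pair. The other two form the relation
    sought.\<close>
  have t134: "B 1 4 1 3 + B 3 4 1 3 = 0" "B 1 3 1 4 + B 3 4 1 4 = 0"
    by (rule cancel[OF t123(2) all diag[of 1 3] pairs'(2)], simp only: ac_simps)
      (rule cancel[OF t124(2) all diag[of 1 4] pairs(3)], simp only: ac_simps)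
  have t234: "B 2 4 2 3 + B 3 4 2 3 = 0" "B 2 3 2 4 + B 3 4 2 4 = 0"
    by (rule cancel[OF t123(1) all diag[of 2 3] pairs'(3)], simp only: ac_simps)
      (rule cancel[OF t124(1) all diag[of 2 4] pairs(2)], simp only: ac_simps)
  have t34: "B 1 3 3 4 + B 1 4 3 4 = 0" "B 2 3 3 4 + B 2 4 3 4 = 0"
    using t134 t234 anti[of 1 3 3 4] anti[of 1 4 3 4] anti[of 1 3 1 4]
      anti[of 2 3 3 4] anti[of 2 4 3 4] anti[of 2 3 2 4]
    by (simp_all add: add_eq_0_iff)
  note facts = t123 t124 t134 t234 t34
  have B3: "B i j j k + B i k j k = 0" if "distinct [i, j, k]" for i j k
    using that facts facts[THEN HOL.trans[OF add.commute]] exhaust4[of i] exhaust4[of j] exhaust4[of k]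
    apply (elim disjE)
    apply (simp_all only: distinct.simps list.set insert_iff empty_iff simp_thms neq4 neq4[symmetric])
    apply (simp_all only: sym1[of 2 1] sym1[of 3 1] sym1[of 4 1] sym1[of 3 2] sym1[of 4 2] sym1[of 4 3] 
        sym2[of _ _ 2 1] sym2[of _ _ 3 1] sym2[of _ _ 4 1] sym2[of _ _ 3 2] sym2[of _ _ 4 2] sym2[of _ _ 4 3])
    done
  show "\<lblot>f i j + f i k, tt j k\<rblot> + \<lblot>tt i j + tt i k, f j k\<rblot> = 0" if "distinct [i, j, k]" for i j k
    using B3[OF that] by (simp add: B_def bracket_distribs algebra_simps)
  have B4: "B i j k l = 0" if "distinct [i, j, k, l]" for i j k l
    using that pairs pairs' exhaust4[of i] exhaust4[of j] exhaust4[of k] exhaust4[of l]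
    apply (elim disjE)
    apply (simp_all only: distinct.simps list.set insert_iff empty_iff simp_thms neq4 neq4[symmetric])
    apply (simp_all only: sym1[of 2 1] sym1[of 3 1] sym1[of 4 1] sym1[of 3 2] sym1[of 4 2] sym1[of 4 3] 
        sym2[of _ _ 2 1] sym2[of _ _ 3 1] sym2[of _ _ 4 1] sym2[of _ _ 3 2] sym2[of _ _ 4 2] sym2[of _ _ 4 3])
    done
  show "\<lblot>f i j, tt k l\<rblot> + \<lblot>tt i j, f k l\<rblot> = 0" if "distinct [i, j, k, l]" for i j k l
    using B4[OF that] by (simp add: B_def)
qed

text \<open>The first summand commutes with \<open>a\<close> and the second with \<open>b\<close>,
  and the two brackets can be interchanged because \<open>a\<close> and \<open>b\<close>
  commute.\<close>

lemma bracket_subst_dk_commute: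
  assumes "\<lblot>a, x\<rblot> = 0" "\<lblot>a, y\<rblot> = 0" "\<lblot>b, u\<rblot> = 0" "\<lblot>b, v\<rblot> = 0" "\<lblot>a, b\<rblot> = 0"
  shows "\<lblot>a, \<lblot>b, subst_dk P x y + subst_dk Q u v\<rblot>\<rblot> = 0"
  using dk.bracket_subst2_0[OF assms(1,2), of P] dk.bracket_subst2_0[OF assms(3,4), of Q] assms(5)
    bracket_bracket_right[of a b "subst_dk P x y"]
  by (simp add: bracket_add_right)

text \<open>The linear part of the pentagon is a t_34 + b t_12; removing strand 4 or strand 1
  isolates one coefficient.\<close>

lemma grt1_lin:
  assumes "C \<in> grt1"
  shows "lin C = 0"
proof -
  obtain a b where ab: "lin C = free_scale a e0 + free_scale b e1" using lin_lie2 by blast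
  have "lin_dk (pent (emb C)) = 0" using assms by (simp add: grt1_def)
  then have "dk_scale a (tt 3 4) + dk_scale b (tt 1 2) = (0 :: ('a, 4) dk)"
    unfolding pent_emb by (simp add: lin_dk_subst ab) (simp add: algebra_simps)
  then have "kill 1 2 3 (dk_scale a (tt 3 4) + dk_scale b (tt 1 2) :: ('a, 4) dk) = 0"
    "kill 2 3 4 (dk_scale a (tt 3 4) + dk_scale b (tt 1 2) :: ('a, 4) dk) = 0" by (simp_all only: kill_simps)
  then show ?thesis by (simp add: ab)
qed

text \<open>This is the third equation of \<open>grt1\<close> with \<open>e0\<close> and
  \<open>e1\<close> interchanged, combined with antisymmetry. It provides the witness for
  \<open>h_of C\<close>.\<close>

lemma grt1_inert:
  assumes "C \<in> grt1"
  shows "\<lblot>C, e0\<rblot> + \<lblot>- subst_lie2 C e1 einf, einf\<rblot> = 0"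
proof -
  have "subst_lie2 C e1 e0 = - C" using assms by (simp add: grt1_def eq_neg_iff_add_eq_0 add.commute)
  moreover have "subst_lie2 (\<lblot>e1, subst_lie2 C e0 e1\<rblot> + \<lblot>einf, subst_lie2 C e0 einf\<rblot>) e1 e0 = 0"
    using assms by (simp add: grt1_def)
  moreover have swap: "- e1 - e0 = (einf :: 'a lie2)" by (simp add: einf_def)
  ultimately have "- \<lblot>e0, C\<rblot> + \<lblot>einf, subst_lie2 C e1 einf\<rblot> = 0"
    using swap by (simp add: subst_lie2_subst_lie2)
  then show ?thesis
    using bracket_anticommute[of e0 C] bracket_anticommute[of einf "subst_lie2 C e1 einf"] by simp
qed

lemma grt1_imp:
  fixes C :: "'k::comm_rat_algebra lie2"
  assumes C: "C \<in> grt1"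
  shows "C \<in> G_inert"
    and "\<exists>D\<in>der (dk_scale :: 'k \<Rightarrow> ('k, 4) dk \<Rightarrow> ('k, 4) dk). \<exists>X :: ('k, 4) dk.
       intertwines mu123 (D_of C) D \<and> intertwines mu124 (D_of C) (\<lambda>x. D x + ad X x)"
proof -
  define h where "h = - subst_lie2 C e1 einf"
  have lin: "lin C = 0" by (rule grt1_lin[OF C])
  have linh: "lin h = 0" by (simp add: h_def lin_subst lin)
  have inert: "\<lblot>C, e0\<rblot> + \<lblot>h, einf\<rblot> = 0" unfolding h_def by (rule grt1_inert[OF C])
  show "C \<in> G_inert" using lin linh inert by (auto simp: G_inert_def frakG_iff)
  have hC: "h_of C = h" by (rule h_of_eqI) (use linh inert in \<open>simp_all add: frakG_iff\<close>)
  have anti: "subst_lie2 C e0 e1 + subst_lie2 C e1 e0 = 0" and pent: "pent (emb C) = 0"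
    using C by (simp_all add: grt1_def)
  note DC = D_of[of C, unfolded hC, OF inert]
  define X :: "('k, 4) dk" where "X = subst_dk C (tt 1 3 + tt 2 3) (tt 1 4 + tt 2 4)"
  define A13 :: "('k, 4) dk" where "A13 = subst_dk h (tt 2 3) (tt 1 2)"
  define A23 :: "('k, 4) dk" where "A23 = subst_dk C (tt 2 3) (tt 1 2)"
  define A14 :: "('k, 4) dk" where "A14 = subst_dk h (tt 2 4) (tt 1 2)"
  define A24 :: "('k, 4) dk" where "A24 = subst_dk C (tt 2 4) (tt 1 2)"
  have X12: "\<lblot>X, tt 1 2\<rblot> = 0"
    unfolding X_def by (rule bracket_eq_0_commute, rule dk.bracket_subst2_0)
      (simp_all add: bracket_add_right tt4_bracket)
  have I: "A13 - (A24 - X) = subst_dk (- C) (tt 2 4) (tt 1 2 + tt 2 3) + subst_dk C (tt 1 3) (tt 1 2 + tt 1 4)"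
    and II: "A23 - (A14 - X) = subst_dk (- C) (tt 1 4) (tt 1 2 + tt 1 3) + subst_dk C (tt 2 3) (tt 1 2 + tt 2 4)"
    using perm_pent[OF lin anti h_def] by (simp_all add: pent X_def A13_def A23_def A14_def A24_def algebra_simps)
  define d13 where "d13 = \<lblot>A13, tt 1 3\<rblot>"
  define d23 where "d23 = \<lblot>A23, tt 2 3\<rblot>"
  \<comment> \<open>Condition (b) prescribes \<open>D + ad X\<close> on the second copy of t_3,
    hence the subtraction of \<open>X\<close>. The value \<open>d34\<close> is chosen so that all
    values add up to zero.\<close>
  define d14 where "d14 = \<lblot>A14 - X, tt 1 4\<rblot>"
  define d24 where "d24 = \<lblot>A24 - X, tt 2 4\<rblot>"
  define d34 where "d34 = - (d14 + d24)"
  define f where "f i j = (if i = j then 0 else if {i, j} = {1, 3} then d13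
    else if {i, j} = {2, 3} then d23 else if {i, j} = {1, 4} then d14
    else if {i, j} = {2, 4} then d24 else if {i, j} = {3, 4} then d34 else 0)" for i j :: 4
  have f [simp]: "f 1 2 = 0" "f 1 3 = d13" "f 2 3 = d23" "f 1 4 = d14" "f 2 4 = d24" "f 3 4 = d34"
    by (simp_all add: f_def doubleton_eq_iff)
  note mu123 = lie_homD[OF lie_hom_mu123] and mu124 = lie_homD[OF lie_hom_mu124]
  have D3: "\<lblot>D_of C a, b\<rblot> + \<lblot>a, D_of C b\<rblot> = 0" if "\<lblot>a, b\<rblot> = 0" for a b
    using derD(6)[OF DC(1), of a b] derD(1)[OF DC(1)] that by simp
  have mu123D: "mu123 (D_of C (tt 1 2)) = 0" "mu123 (D_of C (tt 1 3)) = d13" "mu123 (D_of C (tt 2 3)) = d23"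
    by (simp_all add: DC mu123 d13_def d23_def A13_def A23_def)
  have mu124D: "mu124 (D_of C (tt 1 2)) = 0" "mu124 (D_of C (tt 1 3)) = d14 + \<lblot>X, tt 1 4\<rblot>"
      "mu124 (D_of C (tt 2 3)) = d24 + \<lblot>X, tt 2 4\<rblot>"
    by (simp_all add: DC mu124 d14_def d24_def A14_def A24_def bracket_diff_left)
  have rel: "\<lblot>tt 1 2 + tt 1 3, tt 2 (3::3)\<rblot> = 0" "\<lblot>tt 1 2 + tt 2 3, tt 1 (3::3)\<rblot> = 0"
    "\<lblot>tt 1 3 + tt 2 3, tt 1 (2::3)\<rblot> = 0"
    by (simp_all add: bracket_add_left tt3_bracket)
  have d3: "D_of C (a + b) = D_of C a + D_of C b" for a b by (rule derD(2)[OF DC(1)])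
  have r123: "\<lblot>mu123 (D_of C a), mu123 b\<rblot> + \<lblot>mu123 a, mu123 (D_of C b)\<rblot> = 0" if "\<lblot>a, b\<rblot> = 0" for a b
    using arg_cong[OF D3[OF that], of mu123] by (simp add: mu123)
  have r124: "\<lblot>mu124 (D_of C a), mu124 b\<rblot> + \<lblot>mu124 a, mu124 (D_of C b)\<rblot> = 0" if "\<lblot>a, b\<rblot> = 0" for a b
    using arg_cong[OF D3[OF that], of mu124] by (simp add: mu124)
  have adX: "\<lblot>\<lblot>X, a\<rblot>, b\<rblot> + \<lblot>a, \<lblot>X, b\<rblot>\<rblot> = 0" if "\<lblot>a, b\<rblot> = 0" for a b
    using bracket_bracket_right[of X a b] that by simp
  \<comment> \<open>Inner derivations respect every relation, so the contribution of
    \<open>X\<close> can be removed from the relations transported from t_3.\<close>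
  have t124: "\<lblot>a', tt i j\<rblot> + \<lblot>a, b'\<rblot> = 0"
    if "\<lblot>a' + \<lblot>X, a\<rblot>, tt i j\<rblot> + \<lblot>a, b' + \<lblot>X, tt i j\<rblot>\<rblot> = 0" "\<lblot>a, tt i j\<rblot> = 0" for a a' b' and i j :: 4
    using that(1) adX[OF that(2)] by (simp add: bracket_distribs add_eq_0_iff algebra_simps)
  have "subst_dk (\<lblot>C, e0\<rblot> + \<lblot>h, einf\<rblot>) (tt 2 3) (tt 1 2) = (0 :: ('k, 3) dk)" using inert by simp
  moreover have "- tt 2 3 - tt 1 2 = tt 1 3 - (c3 :: ('k, 3) dk)" by (simp add: c3_def algebra_simps)
  ultimately have sum: "D_of C (tt 1 3) + D_of C (tt 2 3) = 0"
    by (simp add: DC bracket_diff_right add.commute)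
  have sum23: "d13 + d23 = 0"
    using arg_cong[OF sum, of mu123] by (simp only: mu123 mu123D)
  have "d14 + \<lblot>X, tt 1 4\<rblot> + (d24 + \<lblot>X, tt 2 4\<rblot>) = 0"
    using arg_cong[OF sum, of mu124] by (simp only: mu124 mu124D)
  then have sum24: "d14 + d24 = - \<lblot>X, tt 1 4 + tt 2 4\<rblot>"
    by (simp add: bracket_add_right eq_neg_iff_add_eq_0 algebra_simps)
  have "\<exists>D\<in>der dk_scale. \<forall>i j. D (tt i j) = f i j"
  proof (rule ex_der_t4)
    show "f 1 2 + f 1 3 + f 2 3 + f 1 4 + f 2 4 + f 3 4 = 0"
      by (simp add: d34_def sum23)
    show "f j i = f i j" for i j by (simp add: f_def insert_commute eq_commute)
    show "f i i = 0" for i by (simp add: f_def)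
    show "\<lblot>f 1 2, tt 2 3\<rblot> + \<lblot>tt 1 2, f 2 3\<rblot> + (\<lblot>f 1 3, tt 2 3\<rblot> + \<lblot>tt 1 3, f 2 3\<rblot>) = 0"
      using r123[OF rel(1)] by (simp add: d3 mu123 mu123D bracket_distribs algebra_simps)
    show "\<lblot>f 1 2, tt 1 3\<rblot> + \<lblot>tt 1 2, f 1 3\<rblot> + (\<lblot>f 2 3, tt 1 3\<rblot> + \<lblot>tt 2 3, f 1 3\<rblot>) = 0"
      using r123[OF rel(2)] by (simp add: d3 mu123 mu123D bracket_distribs algebra_simps)
    show "\<lblot>f 1 3, tt 1 2\<rblot> + \<lblot>tt 1 3, f 1 2\<rblot> + (\<lblot>f 2 3, tt 1 2\<rblot> + \<lblot>tt 2 3, f 1 2\<rblot>) = 0"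
      using r123[OF rel(3)] by (simp add: d3 mu123 mu123D bracket_distribs algebra_simps)
    show "\<lblot>f 1 2, tt 2 4\<rblot> + \<lblot>tt 1 2, f 2 4\<rblot> + (\<lblot>f 1 4, tt 2 4\<rblot> + \<lblot>tt 1 4, f 2 4\<rblot>) = 0"
      using t124[of d14 "tt 1 2 + tt 1 4" 2 4 d24] r124[OF rel(1)]
      by (simp add: d3 mu124 mu124D bracket_distribs tt4_bracket X12 algebra_simps)
    show "\<lblot>f 1 2, tt 1 4\<rblot> + \<lblot>tt 1 2, f 1 4\<rblot> + (\<lblot>f 2 4, tt 1 4\<rblot> + \<lblot>tt 2 4, f 1 4\<rblot>) = 0"
      using t124[of d24 "tt 1 2 + tt 2 4" 1 4 d14] r124[OF rel(2)]
      by (simp add: d3 mu124 mu124D bracket_distribs tt4_bracket X12 algebra_simps)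
    show "\<lblot>f 1 4, tt 1 2\<rblot> + \<lblot>tt 1 4, f 1 2\<rblot> + (\<lblot>f 2 4, tt 1 2\<rblot> + \<lblot>tt 2 4, f 1 2\<rblot>) = 0"
      using t124[of "d14 + d24" "tt 1 4 + tt 2 4" 1 2 0] r124[OF rel(3)]
      by (simp add: d3 mu124 mu124D bracket_distribs tt4_bracket X12 algebra_simps)
    show "\<lblot>f 1 2, tt 3 4\<rblot> + \<lblot>tt 1 2, f 3 4\<rblot> = 0"
    proof -
      \<comment> \<open>Both \<open>X\<close> and t_14 + t_24 commute with t_12, hence so does their
        bracket, which is \<open>d34\<close>.\<close>
      have "\<lblot>tt 1 2, \<lblot>X, tt 1 4 + tt 2 4\<rblot>\<rblot> = 0"
        using bracket_bracket_right[of "tt 1 2" X "tt 1 4 + tt 2 4"] bracket_eq_0_commute[OF X12]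
        by (simp add: bracket_add_right tt4_bracket)
      then show ?thesis by (simp add: d34_def sum24)
    qed
    \<comment> \<open>The pentagon in the form \<open>I\<close> writes the difference as a part
      commuting with t_13 plus a part commuting with t_24; \<open>II\<close> does the same for t_23
      and t_14.\<close>
    show "\<lblot>f 1 3, tt 2 4\<rblot> + \<lblot>tt 1 3, f 2 4\<rblot> = 0"
      unfolding f d13_def d24_def
      by (subst bracket_commuting_pair, simp add: tt4_bracket, unfold I,
         rule bracket_subst_dk_commute) (simp_all add: bracket_add_right tt4_bracket)
    show "\<lblot>f 2 3, tt 1 4\<rblot> + \<lblot>tt 2 3, f 1 4\<rblot> = 0"
      unfolding f d23_def d14_def
      by (subst bracket_commuting_pair, simp add: tt4_bracket, unfold II,
         rule bracket_subst_dk_commute) (simp_all add: bracket_add_right tt4_bracket)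
  qed
  then obtain D where D: "D \<in> der dk_scale" "\<And>i j. D (tt i j) = f i j" by blast
  have "D (mu123 (tt i j)) = mu123 (D_of C (tt i j))" for i j
    using exhaust3[of i] exhaust3[of j]
    by (elim disjE) (simp_all add: D(2) mu123D mu123(1) derD(1)[OF D(1)] derD(1)[OF DC(1)])
  then have 1: "intertwines mu123 (D_of C) D"
    using dk_der_eqI[OF lie_hom_mu123 DC(1) D(1)] by (simp add: intertwines_def fun_eq_iff)
  have D': "(\<lambda>x. D x + \<lblot>X, x\<rblot>) \<in> der dk_scale" by (intro dk.der_add D(1) dk.der_bracket)
  have "D (mu124 (tt i j)) + \<lblot>X, mu124 (tt i j)\<rblot> = mu124 (D_of C (tt i j))" for i j
    using exhaust3[of i] exhaust3[of j]
    by (elim disjE) (simp_all add: D(2) mu124D mu124(1) X12 derD(1)[OF D(1)] derD(1)[OF DC(1)])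
  then have 2: "intertwines mu124 (D_of C) (\<lambda>x. D x + ad X x)"
    using dk_der_eqI[OF lie_hom_mu124 DC(1) D'] by (simp add: intertwines_def fun_eq_iff ad_def)
  show "\<exists>D\<in>der (dk_scale :: 'k \<Rightarrow> ('k, 4) dk \<Rightarrow> ('k, 4) dk). \<exists>X :: ('k, 4) dk.
       intertwines mu123 (D_of C) D \<and> intertwines mu124 (D_of C) (\<lambda>x. D x + ad X x)"
    using D(1) 1 2 by blast
qed

section \<open>From derivations of \<open>\<tt>\<^sub>4\<close> to \<open>\<gg>\<rr>\<tt>\<^sub>1\<close>\<close>

lemma double_bracket_t13_t24:
  fixes W :: "('k::comm_rat_algebra, 4) dk"
  assumes "\<lblot>tt 1 3, \<lblot>tt 2 4, W\<rblot>\<rblot> = 0"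
  obtains Q R m where
    "W = subst_dk Q (tt 2 4) (tt 1 2 + tt 2 3) + subst_dk R (tt 1 3) (tt 1 2 + tt 1 4) + dk_scale m c4"
proof -
  have inv: "perm 1 3 4 2 (perm 1 4 2 3 z) = z" for z :: "('k, 4) dk"
    by (rule perm_perm, rule tt4_eqI) simp_all
  have "\<lblot>tt 1 2, \<lblot>tt 3 4, perm 1 4 2 3 W\<rblot>\<rblot> = perm 1 4 2 3 \<lblot>tt 1 3, \<lblot>tt 2 4, W\<rblot>\<rblot>" by simp
  then have "\<lblot>tt 1 2, \<lblot>tt 3 4, perm 1 4 2 3 W\<rblot>\<rblot> = 0" using assms by simp
  then obtain Q R m where "perm 1 4 2 3 W =
      subst_dk Q (tt 3 4) (tt 1 4 + tt 2 4) + subst_dk R (tt 1 2) (tt 1 3 + tt 1 4) + dk_scale m c4"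
    by (rule double_bracket_t12_t34)
  then have "W = perm 1 3 4 2 (subst_dk Q (tt 3 4) (tt 1 4 + tt 2 4)
      + subst_dk R (tt 1 2) (tt 1 3 + tt 1 4) + dk_scale m c4)"
    using inv by metis
  then show ?thesis using that[of Q R m] by (simp add: add.commute[of "tt 1 4" "tt 1 2"])
qed

lemma double_bracket_t23_t14:
  fixes W :: "('k::comm_rat_algebra, 4) dk"
  assumes "\<lblot>tt 2 3, \<lblot>tt 1 4, W\<rblot>\<rblot> = 0"
  obtains Q R m where
    "W = subst_dk Q (tt 1 4) (tt 1 2 + tt 1 3) + subst_dk R (tt 2 3) (tt 1 2 + tt 2 4) + dk_scale m c4"
proof -
  have inv: "perm 2 3 4 1 (perm 4 1 2 3 z) = z" for z :: "('k, 4) dk"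
    by (rule perm_perm, rule tt4_eqI) simp_all
  have "\<lblot>tt 1 2, \<lblot>tt 3 4, perm 4 1 2 3 W\<rblot>\<rblot> = perm 4 1 2 3 \<lblot>tt 2 3, \<lblot>tt 1 4, W\<rblot>\<rblot>" by simp
  then have "\<lblot>tt 1 2, \<lblot>tt 3 4, perm 4 1 2 3 W\<rblot>\<rblot> = 0" using assms by simp
  then obtain Q R m where "perm 4 1 2 3 W =
      subst_dk Q (tt 3 4) (tt 1 4 + tt 2 4) + subst_dk R (tt 1 2) (tt 1 3 + tt 1 4) + dk_scale m c4"
    by (rule double_bracket_t12_t34)
  then have "W = perm 2 3 4 1 (subst_dk Q (tt 3 4) (tt 1 4 + tt 2 4)
      + subst_dk R (tt 1 2) (tt 1 3 + tt 1 4) + dk_scale m c4)"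
    using inv by metis
  then show ?thesis using that[of Q R m] by (simp add: add.commute[of "tt 2 4" "tt 1 2"])
qed

lemma subst_dk_nonlinear_part:
  assumes "lin_dk a = a" "lin_dk b = b"
  shows "subst_dk (C - lin C) a b = subst_dk C a b - lin_dk (subst_dk C a b)"
  by (simp add: lin_dk_subst[OF assms])

lemma inert_imp:
  fixes C :: "'k::comm_rat_algebra lie2" and X :: "('k, 4) dk"
  assumes C: "C \<in> G_inert" and D: "D \<in> der dk_scale"
    and a: "intertwines mu123 (D_of C) D"
    and b: "intertwines mu124 (D_of C) (\<lambda>x. D x + ad X x)"
  shows "C \<in> grt1"
proof -
  obtain h where hG: "h \<in> frakG" and inert: "\<lblot>C, e0\<rblot> + \<lblot>h, einf\<rblot> = 0" and CG: "C \<in> frakG"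
    using C by (auto simp: G_inert_def)
  have [simp]: "lin C = 0" "lin h = 0" using hG CG by (simp_all add: frakG_iff)
  have hC: "h_of C = h" by (rule h_of_eqI[OF hG inert])
  note DC = D_of[of C, unfolded hC, OF inert]
  define A13 :: "('k, 4) dk" where "A13 = subst_dk h (tt 2 3) (tt 1 2)"
  define A23 :: "('k, 4) dk" where "A23 = subst_dk C (tt 2 3) (tt 1 2)"
  define A14 :: "('k, 4) dk" where "A14 = subst_dk h (tt 2 4) (tt 1 2)"
  define A24 :: "('k, 4) dk" where "A24 = subst_dk C (tt 2 4) (tt 1 2)"
  have a': "D (mu123 x) = mu123 (D_of C x)" for x
    using a by (simp add: intertwines_def fun_eq_iff)
  have b': "D (mu124 x) + \<lblot>X, mu124 x\<rblot> = mu124 (D_of C x)" for x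
    using b by (simp add: intertwines_def fun_eq_iff ad_def)
  note mu = lie_homD[OF lie_hom_mu123] lie_homD[OF lie_hom_mu124]
  have D12: "D (tt 1 2) = 0" and D13: "D (tt 1 3) = \<lblot>A13, tt 1 3\<rblot>" and D23: "D (tt 2 3) = \<lblot>A23, tt 2 3\<rblot>"
    using a'[of "tt 1 2"] a'[of "tt 1 3"] a'[of "tt 2 3"] by (simp_all add: DC mu A13_def A23_def)
  have X12: "\<lblot>tt 1 2, X\<rblot> = 0"
    using b'[of "tt 1 2"] by (intro bracket_eq_0_commute[of X]) (simp add: DC mu D12)
  have D14: "D (tt 1 4) = \<lblot>A14 - X, tt 1 4\<rblot>" and D24: "D (tt 2 4) = \<lblot>A24 - X, tt 2 4\<rblot>"
    using b'[of "tt 1 3"] b'[of "tt 2 3"]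
    by (simp_all add: DC mu A14_def A24_def bracket_diff_left eq_diff_eq)
  obtain l P m where X: "X = dk_scale l (tt 1 2) + subst_dk P (tt 3 4) (tt 1 3 + tt 2 3) + dk_scale m c4"
    using X12 by (rule centralizer_t12)
  have "\<lblot>\<lblot>A13, tt 1 3\<rblot>, tt 2 4\<rblot> + \<lblot>tt 1 3, \<lblot>A24 - X, tt 2 4\<rblot>\<rblot> = 0"
    using derD(6)[OF D, of "tt 1 3" "tt 2 4"] derD(1)[OF D] by (simp add: tt4_bracket D13 D24)
  then have "\<lblot>tt 1 3, \<lblot>tt 2 4, A13 - (A24 - X)\<rblot>\<rblot> = 0"
    by (simp only: bracket_commuting_pair[OF tt4_commute(3)])
  then obtain Q R n where WI: "A13 - (A24 - X) =
      subst_dk Q (tt 2 4) (tt 1 2 + tt 2 3) + subst_dk R (tt 1 3) (tt 1 2 + tt 1 4) + dk_scale n c4"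
    by (rule double_bracket_t13_t24)
  have "\<lblot>\<lblot>A23, tt 2 3\<rblot>, tt 1 4\<rblot> + \<lblot>tt 2 3, \<lblot>A14 - X, tt 1 4\<rblot>\<rblot> = 0"
    using derD(6)[OF D, of "tt 2 3" "tt 1 4"] derD(1)[OF D] by (simp add: tt4_bracket D23 D14)
  then have "\<lblot>tt 2 3, \<lblot>tt 1 4, A23 - (A14 - X)\<rblot>\<rblot> = 0"
    by (simp only: bracket_commuting_pair[OF tt4_commute(6)])
  then obtain Q2 R2 n2 where WII: "A23 - (A14 - X) =
      subst_dk Q2 (tt 1 4) (tt 1 2 + tt 1 3) + subst_dk R2 (tt 2 3) (tt 1 2 + tt 2 4) + dk_scale n2 c4"
    by (rule double_bracket_t23_t14)
  \<comment> \<open>Dropping linear parts removes the unknown multiples of t_12 and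
    \<open>c4\<close>, and it makes a substitution vanish as soon as one argument is zero
    (\<open>subst2_lin0\<close>).\<close>
  define P' where "P' = P - lin P"
  define Q' where "Q' = Q - lin Q"
  define R' where "R' = R - lin R"
  define Q2' where "Q2' = Q2 - lin Q2"
  define R2' where "R2' = R2 - lin R2"
  have [simp]: "lin P' = 0" "lin Q' = 0" "lin R' = 0" "lin Q2' = 0" "lin R2' = 0"
    by (simp_all add: P'_def Q'_def R'_def Q2'_def R2'_def)
  have [simp]: "lin_dk c4 = (c4 :: ('k, 4) dk)" by (simp add: c4_def)
  have lA: "lin_dk A13 = 0" "lin_dk A23 = 0" "lin_dk A14 = 0" "lin_dk A24 = 0"
    by (simp_all add: A13_def A23_def A14_def A24_def lin_dk_subst)
  have X': "subst_dk P' (tt 3 4) (tt 1 3 + tt 2 3) = X - lin_dk X"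
    unfolding P'_def by (subst subst_dk_nonlinear_part) (simp_all add: X)
  have I: "A13 - A24 + subst_dk P' (tt 3 4) (tt 1 3 + tt 2 3) =
      subst_dk Q' (tt 2 4) (tt 1 2 + tt 2 3) + subst_dk R' (tt 1 3) (tt 1 2 + tt 1 4)"
  proof -
    have "A13 - A24 + (X - lin_dk X) = (A13 - (A24 - X)) - lin_dk (A13 - (A24 - X))"
      by (simp add: lA)
    then show ?thesis unfolding X' unfolding WI Q'_def R'_def
      by (simp add: lin_dk_subst algebra_simps)
  qed
  have II: "A23 - A14 + subst_dk P' (tt 3 4) (tt 1 3 + tt 2 3) =
      subst_dk Q2' (tt 1 4) (tt 1 2 + tt 1 3) + subst_dk R2' (tt 2 3) (tt 1 2 + tt 2 4)"
  proof -
    have "A23 - A14 + (X - lin_dk X) = (A23 - (A14 - X)) - lin_dk (A23 - (A14 - X))"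
      by (simp add: lA)
    then show ?thesis unfolding X' unfolding WII Q2'_def R2'_def
      by (simp add: lin_dk_subst algebra_simps)
  qed
  note defs = A13_def A23_def A14_def A24_def
  \<comment> \<open>Removing a strand sends an argument of most terms to zero, which leaves one
    relation between elements of the free Lie algebra.\<close>
  have I1: "P' = subst_lie2 Q' einf e1" using arg_cong[OF I, of "kill 2 3 4"]
    by (simp add: defs free_lie.subst2_lin0)
  have I2: "P' = subst_lie2 R' e1 einf" using arg_cong[OF I, of "kill 1 3 4"]
    by (simp add: defs free_lie.subst2_lin0)
  have I3: "- C = Q'" using arg_cong[OF I, of "kill 1 2 4"]
    by (simp add: defs free_lie.subst2_lin0)
  have II1: "P' = subst_lie2 R2' e1 einf" using arg_cong[OF II, of "kill 2 3 4"]
    by (simp add: defs free_lie.subst2_lin0)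
  have II2: "P' = subst_lie2 Q2' einf e1" using arg_cong[OF II, of "kill 1 3 4"]
    by (simp add: defs free_lie.subst2_lin0)
  have II3: "- h = subst_lie2 Q2' einf e1" using arg_cong[OF II, of "kill 1 2 4"]
    by (simp add: defs free_lie.subst2_lin0)
  have II4: "C = R2'" using arg_cong[OF II, of "kill 1 2 3"]
    by (simp add: defs free_lie.subst2_lin0)
  have P': "P' = subst_lie2 C e1 einf" using II1 II4 by simp
  have h: "h = - subst_lie2 C e1 einf" using II2 II3 P' by (metis minus_minus)
  have rot: "- einf - e0 = (e1 :: 'k lie2)" "- e1 - e0 = (einf :: 'k lie2)" by (simp_all add: einf_def)
  have "subst_lie2 C e1 einf = - subst_lie2 C einf e1" using P' I1 I3[symmetric] by simp
  \<comment> \<open>Substituting \<open>einf\<close> for \<open>e0\<close> and \<open>e0\<close> for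
    \<open>e1\<close> carries \<open>einf\<close> to \<open>e1\<close>, so it undoes the rotation
    from (\<open>e0\<close>, \<open>e1\<close>) to (\<open>e1\<close>, \<open>einf\<close>).\<close>
  then have "subst_lie2 (subst_lie2 C e1 einf) einf e0 = subst_lie2 (- subst_lie2 C einf e1) einf e0"
    by simp
  then have "C = - subst_lie2 C e1 e0" by (simp add: subst_lie2_subst_lie2 rot)
  then have C10: "subst_lie2 C e1 e0 = - C" by (metis minus_minus)
  then have anti: "subst_lie2 C e0 e1 + subst_lie2 C e1 e0 = 0" by simp
  have R': "R' = C"
  proof -
    have "subst_lie2 (subst_lie2 R' e1 einf) einf e0 = subst_lie2 (subst_lie2 C e1 einf) einf e0"
      using I2 P' by simp
    then show ?thesis by (simp add: subst_lie2_subst_lie2 rot)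
  qed
  \<comment> \<open>This identifies \<open>X\<close>, up to its linear part, with the element chosen
    in the converse direction.\<close>
  have "subst_dk C (tt 1 3 + tt 2 3) (- tt 3 4 - (tt 1 3 + tt 2 3)) =
      subst_dk C (tt 1 3 + tt 2 3) (tt 1 4 + tt 2 (4::4))"
  proof (rule dk.subst2_einf_shift)
    have "tt 3 4 + (tt 1 3 + tt 2 3) + (tt 1 4 + tt 2 4) = c4 - (tt 1 2 :: ('k, 4) dk)"
      by (simp add: c4_def algebra_simps)
    then show "\<lblot>tt 3 4 + (tt 1 3 + tt 2 3) + (tt 1 4 + tt 2 4), tt 3 4 :: ('k, 4) dk\<rblot> = 0"
      "\<lblot>tt 3 4 + (tt 1 3 + tt 2 3) + (tt 1 4 + tt 2 4), tt 1 3 + tt 2 3 :: ('k, 4) dk\<rblot> = 0"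
      by (simp_all add: bracket_diff_left bracket_add_right tt4_bracket)
  qed simp
  then have "subst_dk P' (tt 3 4) (tt 1 3 + tt 2 3) =
      subst_dk C (tt 1 3 + tt 2 3) (tt 1 4 + tt 2 (4::4))"
    unfolding P' by (simp add: subst_dk_subst_lie2)
  then have "perm 3 1 2 4 (pent (emb C)) = 0"
    using I unfolding perm_pent(1)[OF \<open>lin C = 0\<close> anti h] R' I3[symmetric] defs by simp
  moreover have "perm 2 3 1 4 (perm 3 1 2 4 z) = z" for z :: "('k, 4) dk"
    by (rule perm_perm, rule tt4_eqI) simp_all
  ultimately have pent: "pent (emb C) = 0" by (metis perm_simps(1))
  \<comment> \<open>Interchanging \<open>e0\<close> and \<open>e1\<close> in the inertia equation
    gives the third equation of \<open>grt1\<close>.\<close>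
  have "subst_lie2 (\<lblot>C, e0\<rblot> + \<lblot>h, einf\<rblot>) e1 e0 = 0" by (simp add: inert)
  then have "- \<lblot>C, e1\<rblot> - \<lblot>subst_lie2 C e0 einf, einf\<rblot> = 0"
    by (simp add: h subst_lie2_subst_lie2 rot C10)
  then have third: "\<lblot>e1, C\<rblot> + \<lblot>einf, subst_lie2 C e0 einf\<rblot> = 0"
    using bracket_anticommute[of e1 C] bracket_anticommute[of einf "subst_lie2 C e0 einf"] by simp
  have "subst_lie2 (subst_lie2 C e1 e0) einf e0 = subst_lie2 (- C) einf e0" by (simp only: C10)
  then have G: "subst_lie2 C e0 einf = - subst_lie2 C einf e0"
    by (simp add: subst_lie2_subst_lie2)
  have "C + subst_lie2 C e1 einf + subst_lie2 C einf e0 = 0"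
  proof (rule centralizer_einf)
    have "\<lblot>einf, subst_lie2 C e1 einf\<rblot> = \<lblot>e0, C\<rblot>"
      using inert bracket_anticommute[of e0 C] bracket_anticommute[of einf "subst_lie2 C e1 einf"]
      by (simp add: h)
    moreover have "\<lblot>einf, subst_lie2 C einf e0\<rblot> = \<lblot>e1, C\<rblot>"
      using third by (simp add: G)
    moreover have "\<lblot>einf, C\<rblot> = - \<lblot>e0, C\<rblot> - \<lblot>e1, C\<rblot>" by (simp add: einf_def bracket_diff_left)
    ultimately show "\<lblot>einf, C + subst_lie2 C e1 einf + subst_lie2 C einf e0\<rblot> = 0"
      by (simp add: bracket_add_right)
  qed (simp add: lin_subst)
  then show ?thesis using anti third pent by (simp add: grt1_def)
qed

theorem theorem2:
  shows "(grt1 :: 'k::comm_rat_algebra lie2 set) =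
    {C \<in> G_inert. \<exists>D \<in> der (dk_scale :: 'k \<Rightarrow> ('k, 4) dk \<Rightarrow> ('k, 4) dk). \<exists>X :: ('k, 4) dk.
       intertwines mu123 (D_of C) D \<and>
       intertwines mu124 (D_of C) (\<lambda>x. D x + ad X x)}"
  using grt1_imp inert_imp by blast

end
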